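(* Let $k\ge2$ and let $\mu$ be a probability measure on $\mathbb{R}$ satisfying the standing assumptions below and $\int_{\mathbb{R}}|x|\,d\mu<+\infty$. Let $\nu$ be a solution to $\min_{\lambda\in\mathcal{P}_k(\mathbb{R})}W_1(\mu,\lambda)$ with support points $y_1\le y_2\le\dots\le y_k$. Then $\vec v_\mu=(F_\mu(y_1),\dots,F_\mu(y_k))\in(0,1)^k$ is an optimal percentile vector, and $y_1,\dots,y_k$ satisfy the system \[ \begin{cases} 2F_\mu(y_1)=F_\mu\big(\tfrac{y_1+y_2}{2}\big),\\[2pt] 2\Big(F_\mu(y_j)-F_\mu\big(\tfrac{y_{j-1}+y_j}{2}\big)\Big)=F_\mu\big(\tfrac{y_j+y_{j+1}}{2}\big)-F_\mu\big(\tfrac{y_{j-1}+y_j}{2}\big),\quad j=2,\dots,k-1,\\[2pt] 2\Big(F_\mu(y_k)-F_\mu\big(\tfrac{y_{k-1}+y_k}{2}\big)\Big)=1-F_\mu\big(\tfrac{y_{k-1}+y_k}{2}\big). \end{cases} \]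
   Context: For $\vec x\in\mathbb{R}^n$, $\vec y\in\mathbb{R}^k$: $SC(\vec x,\vec y)=\frac1n\sum_i\min_j|x_i-y_j|$, $SC_{opt}(\vec x)=\min_{\vec y}SC(\vec x,\vec y)$. A percentile vector is $\vec v$ with $0\le v_1\le\dots\le v_k\le1$; $\mathcal{PM}_{\vec v}$ sorts the reports $x_{(1)}\le\dots\le x_{(n)}$ and places facility $j$ at $x_{(\lfloor(n-1)v_j\rfloor+1)}$. With $\vec X_n$ i.i.d. of law $\mu$, $B^{(n)}_{ar}(f)=\mathbb{E}[SC_f(\vec X_n)]/\mathbb{E}[SC_{opt}(\vec X_n)]$; a percentile vector is optimal for $\mu$ if $\lim_n B^{(n)}_{ar}$ of its mechanism equals $1$. $\mathcal{P}_k(\mathbb{R})$: probability measures $\sum_{j=1}^k\nu_j\delta_{x_j}$. $W_1$: 1-Wasserstein distance. $F_\mu$: c.d.f. of $\mu$. Standing assumptions on $\mu$: absolutely continuous with density $\rho_\mu$; support an interval on whose interior $\rho_\mu>0$; $\rho_\mu$ differentiable on the support. *)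

theory Defs
  imports "HOL-Probability.Probability"
begin

definition couplings :: "real measure \<Rightarrow> real measure \<Rightarrow> (real \<times> real) measure set" where
  "couplings \<mu> \<nu> = {\<pi>. prob_space \<pi> \<and> sets \<pi> = sets (borel :: (real \<times> real) measure)
      \<and> distr \<pi> borel fst = \<mu> \<and> distr \<pi> borel snd = \<nu>}"

definition W1 :: "real measure \<Rightarrow> real measure \<Rightarrow> ennreal" where
  "W1 \<mu> \<nu> = (INF \<pi> \<in> couplings \<mu> \<nu>. \<integral>\<^sup>+ p. ennreal \<bar>fst p - snd p\<bar> \<partial>\<pi>)"

definition discrete_meas :: "nat \<Rightarrow> (nat \<Rightarrow> real) \<Rightarrow> (nat \<Rightarrow> real) \<Rightarrow> real measure" where
  "discrete_meas k x w = measure_of UNIV (sets borel)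
      (\<lambda>A. \<Sum>j\<in>{1..k}. ennreal (w j) * indicator A (x j))"

definition Pk :: "nat \<Rightarrow> real measure set" where
  "Pk k = {discrete_meas k x w | x w. (\<forall>j\<in>{1..k}. 0 \<le> w j) \<and> (\<Sum>j\<in>{1..k}. w j) = 1}"

definition cdf_of :: "real measure \<Rightarrow> real \<Rightarrow> real" where
  "cdf_of \<mu> t = measure \<mu> {..t}"

text \<open>Reports x_0,...,x_{n-1}; facilities y_1,...,y_k.\<close>
definition SC :: "nat \<Rightarrow> nat \<Rightarrow> (nat \<Rightarrow> real) \<Rightarrow> (nat \<Rightarrow> real) \<Rightarrow> real" where
  "SC n k x y = (1 / real n) * (\<Sum>i<n. Min {\<bar>x i - y j\<bar> | j. j \<in> {1..k}})"

definition SC_opt :: "nat \<Rightarrow> nat \<Rightarrow> (nat \<Rightarrow> real) \<Rightarrow> real" where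
  "SC_opt n k x = (INF y \<in> (UNIV :: (nat \<Rightarrow> real) set). SC n k x y)"

text \<open>m-th order statistic (1-based) of x_0,...,x_{n-1}.\<close>
definition order_stat :: "nat \<Rightarrow> (nat \<Rightarrow> real) \<Rightarrow> nat \<Rightarrow> real" where
  "order_stat n x m = sort (map x [0..<n]) ! (m - 1)"

definition percentile_vector :: "nat \<Rightarrow> (nat \<Rightarrow> real) \<Rightarrow> bool" where
  "percentile_vector k v \<longleftrightarrow> (\<forall>j\<in>{1..k}. 0 \<le> v j \<and> v j \<le> 1)
      \<and> (\<forall>i j. 1 \<le> i \<longrightarrow> i \<le> j \<longrightarrow> j \<le> k \<longrightarrow> v i \<le> v j)"

definition PM :: "nat \<Rightarrow> (nat \<Rightarrow> real) \<Rightarrow> (nat \<Rightarrow> real) \<Rightarrow> (nat \<Rightarrow> real)" where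
  "PM n v x = (\<lambda>j. order_stat n x (nat \<lfloor>(real n - 1) * v j\<rfloor> + 1))"

definition B_ar :: "real measure \<Rightarrow> nat \<Rightarrow> nat \<Rightarrow> (nat \<Rightarrow> real) \<Rightarrow> real" where
  "B_ar \<mu> k n v =
     (\<integral>x. SC n k x (PM n v x) \<partial>(PiM {..<n} (\<lambda>_. \<mu>))) /
     (\<integral>x. SC_opt n k x \<partial>(PiM {..<n} (\<lambda>_. \<mu>)))"

definition optimal_percentile_vector :: "real measure \<Rightarrow> nat \<Rightarrow> (nat \<Rightarrow> real) \<Rightarrow> bool" where
  "optimal_percentile_vector \<mu> k v \<longleftrightarrow> percentile_vector k v \<and> (\<lambda>n. B_ar \<mu> k n v) \<longlonglongrightarrow> 1"

definition standing_assumptions :: "real measure \<Rightarrow> bool" where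
  "standing_assumptions \<mu> \<longleftrightarrow> prob_space \<mu> \<and>
     (\<exists>\<rho> I. \<rho> \<in> borel_measurable borel \<and> (\<forall>x. 0 \<le> \<rho> x) \<and>
        \<mu> = density lborel (\<lambda>x. ennreal (\<rho> x)) \<and>
        is_interval I \<and> closed I \<and> interior I \<noteq> {} \<and>
        (\<forall>x. x \<notin> I \<longrightarrow> \<rho> x = 0) \<and>
        (\<forall>x\<in>interior I. 0 < \<rho> x) \<and>
        (\<forall>x\<in>I. \<rho> differentiable (at x within I)))"

end

theory Submission
  imports Defs
begin

text \<open>Projecting \<open>\<mu>\<close> to a nearest support point shows that \<open>y\<close> minimises the mean distance
  \<open>G z = \<integral> min\<^sub>j \<bar>x - z\<^sub>j\<bar> d\<mu>\<close>. Moving a single \<open>y\<^sub>j\<close> with the Voronoi cells frozen shows that \<open>y\<^sub>j\<close> is a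
  median of its cell, which is the system; no cell is null, since a point with a null cell could be
  moved to a place where it decreases \<open>G\<close>.

  For the limit, \<open>E SC_opt \<le> E SC(PM) \<le> G y + \<Sum>\<^sub>j E \<bar>PM\<^sub>j - y\<^sub>j\<bar>\<close>, and the sample quantiles converge
  in mean. Conversely \<open>E SC_opt \<ge> G y - o(1)\<close>, because \<open>SC\<close> approximates \<open>G\<close> uniformly in \<open>z\<close>:
  up to a small \<open>L\<^sup>1\<close> error the sample takes finitely many values, and their empirical frequencies
  converge in \<open>L\<^sup>2\<close>. As \<open>G y > 0\<close>, the quotient tends to 1.\<close>

subsection \<open>Distance to the facilities and the Wasserstein problem\<close>

text \<open>The lower bound on \<open>SC_opt\<close> is the delicate half: its infimum runs over an
  unbounded set of positions, and a law of large numbers at a single \<open>y\<close> yields only an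
  upper bound. Compactness is replaced by the fact that \<open>fdist k y\<close> is 1-Lipschitz for
  every \<open>y\<close>: moving the sample points costs the same for all \<open>y\<close> at once.

  On a null cell the median equation only says 0 = 0, which is why such cells must be excluded. With
  positive mass, the first and the last equation give F(y_1) > 0 and F(y_k) < 1, so all levels lie
  strictly between 0 and 1. This places every \<open>y j\<close> in the interior of the support,
  where F increases strictly, so \<open>y j\<close> is the only quantile of its level, as
  convergence of sample quantiles requires. That convergence has to hold in mean, because costs are
  compared by expectation; the first moment of \<mu> controls the tails.\<close>

definition fdist :: "nat \<Rightarrow> (nat \<Rightarrow> real) \<Rightarrow> real \<Rightarrow> real" where
  "fdist k y x = Min ((\<lambda>j. \<bar>x - y j\<bar>) ` {1..k})"

lemma SC_fdist: "SC n k x y = (1 / real n) * (\<Sum>i<n. fdist k y (x i))"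
  unfolding SC_def fdist_def Setcompr_eq_image ..

lemma fdist_le: "j \<in> {1..k} \<Longrightarrow> fdist k y x \<le> \<bar>x - y j\<bar>"
  unfolding fdist_def by (rule Min_le) auto

lemma fdist_attained:
  assumes "1 \<le> k"
  obtains j where "j \<in> {1..k}" "fdist k y x = \<bar>x - y j\<bar>"
proof -
  have "fdist k y x \<in> (\<lambda>j. \<bar>x - y j\<bar>) ` {1..k}"
    unfolding fdist_def using assms by (intro Min_in) auto
  then show ?thesis using that by auto
qed

lemma fdist_nonneg: "1 \<le> k \<Longrightarrow> 0 \<le> fdist k y x"
  by (metis abs_ge_zero fdist_attained)

text \<open>The facility nearest to \<open>x\<close> under \<open>y\<close> stays available after
  being moved. The sum of all displacements is cruder than their maximum, but its expectation splits
  into one term per facility.\<close>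

lemma fdist_perturb:
  assumes "1 \<le> k"
  shows "fdist k z x \<le> fdist k y x + (\<Sum>j\<in>{1..k}. \<bar>z j - y j\<bar>)"
proof -
  obtain j where j: "j \<in> {1..k}" "fdist k y x = \<bar>x - y j\<bar>"
    using fdist_attained[OF assms] .
  have "\<bar>z j - y j\<bar> \<le> (\<Sum>j\<in>{1..k}. \<bar>z j - y j\<bar>)"
    using j by (intro member_le_sum) auto
  then show ?thesis using fdist_le[OF j(1), of z x] j(2) by linarith
qed

lemma fdist_lipschitz:
  assumes "1 \<le> k"
  shows "\<bar>fdist k y x - fdist k y z\<bar> \<le> \<bar>x - z\<bar>"
proof -
  obtain i where i: "i \<in> {1..k}" "fdist k y x = \<bar>x - y i\<bar>"
    using fdist_attained[OF assms] .
  obtain j where j: "j \<in> {1..k}" "fdist k y z = \<bar>z - y j\<bar>"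
    using fdist_attained[OF assms] .
  show ?thesis
    using fdist_le[OF i(1), of y z] fdist_le[OF j(1), of y x] i(2) j(2) by linarith
qed

lemma borel_measurable_fdist [measurable]:
  assumes "1 \<le> k"
  shows "fdist k y \<in> borel_measurable borel"
proof (intro borel_measurable_continuous_onI)
  have "1-lipschitz_on UNIV (fdist k y)"
    using fdist_lipschitz[OF assms] by (intro lipschitz_onI) (auto simp: dist_real_def)
  then show "continuous_on UNIV (fdist k y)"
    by (rule lipschitz_on_continuous_on)
qed

lemma SC_perturb:
  assumes "1 \<le> k"
  shows "SC n k x z \<le> SC n k x y + (\<Sum>j\<in>{1..k}. \<bar>z j - y j\<bar>)"
proof (cases "n = 0")
  case True
  then show ?thesis by (simp add: SC_fdist sum_nonneg)
next
  case False
  have "(\<Sum>i<n. fdist k z (x i)) \<le> (\<Sum>i<n. fdist k y (x i) + (\<Sum>j\<in>{1..k}. \<bar>z j - y j\<bar>))"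
    by (intro sum_mono fdist_perturb assms)
  also have "\<dots> = (\<Sum>i<n. fdist k y (x i)) + real n * (\<Sum>j\<in>{1..k}. \<bar>z j - y j\<bar>)"
    by (simp add: sum.distrib)
  finally show ?thesis using False unfolding SC_fdist by (simp add: field_simps)
qed

lemma SC_nonneg: "1 \<le> k \<Longrightarrow> 0 \<le> SC n k x y"
  unfolding SC_fdist by (intro mult_nonneg_nonneg sum_nonneg fdist_nonneg) auto

lemma bdd_below_SC: "1 \<le> k \<Longrightarrow> bdd_below (SC n k x ` A)"
  using SC_nonneg by (intro bdd_belowI2[where m = 0]) auto

lemma SC_opt_le: "1 \<le> k \<Longrightarrow> SC_opt n k x \<le> SC n k x y"
  unfolding SC_opt_def by (intro cINF_lower bdd_below_SC) auto

lemma SC_opt_greatest: "(\<And>y. c \<le> SC n k x y) \<Longrightarrow> c \<le> SC_opt n k x"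
  unfolding SC_opt_def by (intro cINF_greatest) auto

text \<open>This serves the measurability of \<open>SC_opt\<close>, an infimum over uncountably many
  positions. The family is \<open>PiE\<close> and not all rational-valued functions on
  \<open>nat\<close>, which would again be uncountable; values outside \<open>{1..k}\<close> do not
  affect \<open>SC\<close>.\<close>

lemma SC_opt_rational:
  assumes "1 \<le> k"
  shows "SC_opt n k x = (INF y \<in> PiE {1..k} (\<lambda>_. \<rat>). SC n k x y)"
proof (rule antisym)
  have ne: "PiE {1..k} (\<lambda>_. \<rat> :: real set) \<noteq> {}"
    by (auto simp: PiE_eq_empty_iff intro: Rats_0)
  then show "SC_opt n k x \<le> (INF y \<in> PiE {1..k} (\<lambda>_. \<rat>). SC n k x y)"
    by (intro cINF_greatest SC_opt_le assms)
  show "(INF y \<in> PiE {1..k} (\<lambda>_. \<rat>). SC n k x y) \<le> SC_opt n k x"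
  proof (rule SC_opt_greatest, rule field_le_epsilon)
    fix y :: "nat \<Rightarrow> real" and e :: real assume e: "0 < e"
    have "\<exists>q\<in>\<rat>. \<bar>q - y j\<bar> < e / real k" for j
    proof -
      obtain q where "q \<in> \<rat>" "y j < q" "q < y j + e / real k"
        using Rats_dense_in_real[of "y j" "y j + e / real k"] e assms by auto
      then show ?thesis by (intro bexI[of _ q]) auto
    qed
    then obtain q where q: "\<And>j. q j \<in> \<rat>" "\<And>j. \<bar>q j - y j\<bar> < e / real k"
      by metis
    have "restrict q {1..k} \<in> PiE {1..k} (\<lambda>_. \<rat>)" using q by auto
    then have "(INF y \<in> PiE {1..k} (\<lambda>_. \<rat>). SC n k x y) \<le> SC n k x (restrict q {1..k})"
      by (intro cINF_lower bdd_below_SC assms)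
    also have "\<dots> \<le> SC n k x y + (\<Sum>j\<in>{1..k}. \<bar>restrict q {1..k} j - y j\<bar>)"
      by (rule SC_perturb[OF assms])
    also have "(\<Sum>j\<in>{1..k}. \<bar>restrict q {1..k} j - y j\<bar>) \<le> (\<Sum>j\<in>{1..k}. e / real k)"
      using q(2) by (intro sum_mono) (auto simp: less_imp_le)
    also have "\<dots> = e" using assms by simp
    finally show "(INF y \<in> PiE {1..k} (\<lambda>_. \<rat>). SC n k x y) \<le> SC n k x y + e" by simp
  qed
qed

section \<open>Mean distance and transport cost to measures with k support points\<close>

lemma sets_discrete_meas [simp]: "sets (discrete_meas k x w) = sets borel"
  unfolding discrete_meas_def using sets.sigma_sets_eq[of borel] by (simp add: sets_measure_of_conv)

text \<open>\<open>measure_of\<close> reproduces the given set function only if that is countably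
  additive. Additivity comes for free once the set function is recognised as the image under
  \<open>x\<close> of the point measure with weights \<open>w\<close> on the index set; working on
  indices lets points \<open>x j\<close> coincide.\<close>

lemma emeasure_discrete_meas:
  assumes "A \<in> sets borel"
  shows "emeasure (discrete_meas k x w) A = (\<Sum>j\<in>{1..k}. ennreal (w j) * indicator A (x j))"
proof -
  let ?P = "point_measure {1..k} (\<lambda>j. ennreal (w j))"
  have D: "emeasure (distr ?P borel x) B = (\<Sum>j\<in>{1..k}. ennreal (w j) * indicator B (x j))"
    if "B \<in> sets borel" for B
  proof -
    have "emeasure (distr ?P borel x) B = emeasure ?P (x -` B \<inter> {1..k})"
      using that by (subst emeasure_distr) (auto simp: space_point_measure)
    also have "\<dots> = (\<Sum>j\<in>x -` B \<inter> {1..k}. ennreal (w j))"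
      by (intro emeasure_point_measure_finite) auto
    also have "\<dots> = (\<Sum>j\<in>{1..k}. ennreal (w j) * indicator B (x j))"
      by (intro sum.mono_neutral_cong_left) (auto simp: indicator_def)
    finally show ?thesis .
  qed
  have "discrete_meas k x w = measure_of (space (distr ?P borel x)) (sets (distr ?P borel x))
      (emeasure (distr ?P borel x))"
    unfolding discrete_meas_def
    unfolding space_distr sets_distr space_borel
  proof (rule measure_of_eq)
    fix B :: "real set" assume "B \<in> sigma_sets UNIV (sets borel)"
    then show "(\<Sum>j\<in>{1..k}. ennreal (w j) * indicator B (x j)) = emeasure (distr ?P borel x) B"
      using sets.sigma_sets_eq[of "borel :: real measure"] by (intro D[symmetric]) simp
  qed simp
  then have "discrete_meas k x w = distr ?P borel x"
    by (simp only: measure_of_of_measure)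
  then show ?thesis using D[OF assms] by simp
qed

context real_distribution
begin

definition mean_fdist :: "nat \<Rightarrow> (nat \<Rightarrow> real) \<Rightarrow> real" where
  "mean_fdist k y = (\<integral>x. fdist k y x \<partial>M)"

lemma integrable_fdist:
  assumes "1 \<le> k" "integrable M (\<lambda>x. \<bar>x\<bar>)"
  shows "integrable M (fdist k y)"
proof (rule Bochner_Integration.integrable_bound)
  show "integrable M (\<lambda>x. \<bar>x\<bar> + \<bar>y 1\<bar>)" using assms by simp
  show "AE x in M. norm (fdist k y x) \<le> norm (\<bar>x\<bar> + \<bar>y 1\<bar>)"
  proof (rule AE_I2)
    fix x show "norm (fdist k y x) \<le> norm (\<bar>x\<bar> + \<bar>y 1\<bar>)"
      using fdist_nonneg[OF assms(1), of y x] fdist_le[of 1 k y x] assms(1) by simp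
  qed
qed (use assms in simp)

text \<open>In any coupling the second coordinate is almost surely one of the \<open>y j\<close>, so
  the pair is at least as far apart as the first coordinate is from its nearest facility.\<close>

lemma mean_fdist_le_W1:
  assumes "1 \<le> k" "integrable M (\<lambda>x. \<bar>x\<bar>)"
  shows "ennreal (mean_fdist k y) \<le> W1 M (discrete_meas k y w)"
  unfolding W1_def
proof (rule INF_greatest)
  fix P assume "P \<in> couplings M (discrete_meas k y w)"
  then have sets_P [measurable_cong]: "sets P = sets (borel :: (real \<times> real) measure)"
    and P1: "distr P borel fst = M" and P2: "distr P borel snd = discrete_meas k y w"
    by (auto simp: couplings_def)
  have snd_meas [measurable]: "snd \<in> measurable P borel" and fst_meas [measurable]: "fst \<in> measurable P borel"
    by (auto simp: measurable_cong_sets[OF sets_P refl] borel_prod[symmetric])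
  have fin: "y ` {1..k} \<in> sets borel" by (intro borel_closed finite_imp_closed) auto
  have "emeasure (distr P borel snd) (- y ` {1..k}) = 0"
    using fin unfolding P2 by (subst emeasure_discrete_meas) auto
  then have "AE z in distr P borel snd. z \<in> y ` {1..k}"
    using fin by (intro AE_I[where N = "- y ` {1..k}"]) auto
  then have "AE p in P. snd p \<in> y ` {1..k}"
    using fin by (subst (asm) AE_distr_iff) (auto simp: snd_meas)
  then have ae: "AE p in P. ennreal (fdist k y (fst p)) \<le> ennreal \<bar>fst p - snd p\<bar>"
    by eventually_elim (auto intro!: ennreal_leI fdist_le)
  have "ennreal (mean_fdist k y) = (\<integral>\<^sup>+ x. ennreal (fdist k y x) \<partial>M)"
    unfolding mean_fdist_def
    using fdist_nonneg[OF assms(1)] integrable_fdist[OF assms]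
    by (intro nn_integral_eq_integral[symmetric]) auto
  also have "\<dots> = (\<integral>\<^sup>+ x. ennreal (fdist k y x) \<partial>(distr P borel fst))"
    by (simp add: P1)
  also have "\<dots> = (\<integral>\<^sup>+ p. ennreal (fdist k y (fst p)) \<partial>P)"
    using assms(1) by (intro nn_integral_distr) auto
  also have "\<dots> \<le> (\<integral>\<^sup>+ p. ennreal \<bar>fst p - snd p\<bar> \<partial>P)"
    using ae by (rule nn_integral_mono_AE)
  finally show "ennreal (mean_fdist k y) \<le> (\<integral>\<^sup>+ p. ennreal \<bar>fst p - snd p\<bar> \<partial>P)" .
qed

text \<open>With the weights free, the nearest-facility map is itself a transport map: each
  \<open>x\<close> goes to \<open>y (J x)\<close>, and the weight of index \<open>j\<close> is the
  mass sent there.\<close>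

lemma W1_Pk_le_mean_fdist:
  assumes "1 \<le> k" "integrable M (\<lambda>x. \<bar>x\<bar>)"
  shows "\<exists>\<nu>\<in>Pk k. W1 M \<nu> \<le> ennreal (mean_fdist k y)"
proof -
  \<comment> \<open>\<open>LEAST\<close> breaks ties between equally near facilities and keeps the
    choice measurable.\<close>
  define J where "J x = (LEAST j. j \<in> {1..k} \<and> fdist k y x = \<bar>x - y j\<bar>)" for x
  have J: "J x \<in> {1..k} \<and> fdist k y x = \<bar>x - y (J x)\<bar>" for x
    unfolding J_def by (rule LeastI_ex) (metis fdist_attained[OF assms(1)])
  note [measurable] = borel_measurable_fdist[OF assms(1)]
  have J_meas [measurable]: "J \<in> measurable borel (count_space UNIV)"
    unfolding J_def by measurable
  have T_meas [measurable]: "(\<lambda>x. y (J x)) \<in> borel_measurable borel"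
    by measurable
  define u where "u j = prob {x. J x = j}" for j
  have J_ev: "{x. J x = j} \<in> events" for j
    using measurable_sets[OF J_meas, of "{j}"] by (simp add: vimage_def)
  have u_sum: "(\<Sum>j\<in>{1..k}. u j) = 1"
  proof -
    have "(\<Sum>j\<in>{1..k}. u j) = prob (\<Union>j\<in>{1..k}. {x. J x = j})"
      unfolding u_def using J_ev
      by (intro finite_measure_finite_Union[symmetric]) (auto simp: disjoint_family_on_def)
    also have "(\<Union>j\<in>{1..k}. {x. J x = j}) = space M" using J by (auto simp: space_eq_univ)
    finally show ?thesis by (simp only: prob_space)
  qed
  have T_law: "distr M borel (\<lambda>x. y (J x)) = discrete_meas k y u"
  proof (rule measure_eqI)
    fix A assume "A \<in> sets (distr M borel (\<lambda>x. y (J x)))"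
    then have A: "A \<in> sets borel" by simp
    have "emeasure (distr M borel (\<lambda>x. y (J x))) A = emeasure M ((\<lambda>x. y (J x)) -` A)"
      using A by (subst emeasure_distr) (auto simp: space_eq_univ)
    also have "(\<lambda>x. y (J x)) -` A = (\<Union>j\<in>{j\<in>{1..k}. y j \<in> A}. {x. J x = j})"
      using J by auto
    also have "emeasure M \<dots> = (\<Sum>j\<in>{j\<in>{1..k}. y j \<in> A}. emeasure M {x. J x = j})"
      using J_ev by (intro sum_emeasure[symmetric]) (auto simp: disjoint_family_on_def)
    also have "\<dots> = (\<Sum>j\<in>{1..k}. ennreal (u j) * indicator A (y j))"
      unfolding u_def by (intro sum.mono_neutral_cong_left) (auto simp: indicator_def emeasure_eq_measure)
    also have "\<dots> = emeasure (discrete_meas k y u) A"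
      using A by (simp add: emeasure_discrete_meas)
    finally show "emeasure (distr M borel (\<lambda>x. y (J x))) A = emeasure (discrete_meas k y u) A" .
  qed simp
  \<comment> \<open>The coupling is concentrated on the graph of the nearest-facility map, so its
    cost is exactly \<open>mean_fdist k y\<close>.\<close>
  let ?P = "distr M borel (\<lambda>x. (x, y (J x)))"
  have pair_meas [measurable]: "(\<lambda>x. (x, y (J x))) \<in> measurable M borel"
    unfolding borel_prod[symmetric] by measurable
  have proj [measurable]: "fst \<in> borel_measurable (borel :: (real \<times> real) measure)"
      "snd \<in> borel_measurable (borel :: (real \<times> real) measure)"
    using measurable_fst[of "borel :: real measure" "borel :: real measure"]
      measurable_snd[of "borel :: real measure" "borel :: real measure"]
    by (simp_all add: borel_prod)
  have "?P \<in> couplings M (discrete_meas k y u)"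
  proof -
    have "distr ?P borel fst = distr M borel (\<lambda>x. x)"
      by (subst distr_distr) (auto simp: o_def)
    also have "\<dots> = distr M M (\<lambda>x. x)"
      by (intro distr_cong) auto
    finally have 1: "distr ?P borel fst = M" by (simp add: distr_id2)
    have "distr ?P borel snd = discrete_meas k y u"
      by (subst distr_distr) (auto simp: o_def T_law)
    with 1 show ?thesis
      unfolding couplings_def by (auto intro: prob_space_distr pair_meas)
  qed
  then have "W1 M (discrete_meas k y u) \<le> (\<integral>\<^sup>+ p. ennreal \<bar>fst p - snd p\<bar> \<partial>?P)"
    unfolding W1_def by (rule INF_lower)
  also have "\<dots> = (\<integral>\<^sup>+ x. ennreal (fdist k y x) \<partial>M)"
    using J by (subst nn_integral_distr) auto
  also have "\<dots> = ennreal (mean_fdist k y)"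
    unfolding mean_fdist_def
    using fdist_nonneg[OF assms(1)] integrable_fdist[OF assms]
    by (intro nn_integral_eq_integral) auto
  finally have "W1 M (discrete_meas k y u) \<le> ennreal (mean_fdist k y)" .
  moreover have "\<forall>j\<in>{1..k}. 0 \<le> u j" by (simp add: u_def)
  then have "discrete_meas k y u \<in> Pk k" unfolding Pk_def using u_sum by blast
  ultimately show ?thesis by blast
qed

text \<open>Well chosen weights on \<open>z\<close> give a competitor in \<open>Pk k\<close>, and
  the two preceding bounds enclose the comparison of the \<open>W1\<close> values. The transport
  problem enters the rest of the argument only through this inequality.\<close>

lemma W1_minimiser_mean_fdist_le:
  assumes "1 \<le> k" "integrable M (\<lambda>x. \<bar>x\<bar>)"
    and "\<forall>\<nu>\<in>Pk k. W1 M (discrete_meas k y w) \<le> W1 M \<nu>"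
  shows "mean_fdist k y \<le> mean_fdist k z"
proof -
  obtain \<nu> where "\<nu> \<in> Pk k" "W1 M \<nu> \<le> ennreal (mean_fdist k z)"
    using W1_Pk_le_mean_fdist[OF assms(1,2)] by blast
  then have "ennreal (mean_fdist k y) \<le> ennreal (mean_fdist k z)"
    using assms(3) mean_fdist_le_W1[OF assms(1,2), of y w] by (meson order_trans)
  moreover have "0 \<le> mean_fdist k z"
    unfolding mean_fdist_def by (intro Bochner_Integration.integral_nonneg fdist_nonneg assms)
  ultimately show ?thesis by simp
qed

end

subsection \<open>Voronoi cells\<close>

text \<open>The Voronoi cell of \<open>y j\<close>; a boundary point belongs to the cell on its left.\<close>
definition cell :: "nat \<Rightarrow> (nat \<Rightarrow> real) \<Rightarrow> nat \<Rightarrow> real set" where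
  "cell k y j = {x. (j = 1 \<or> (y (j - 1) + y j) / 2 < x) \<and> (j = k \<or> x \<le> (y j + y (j + 1)) / 2)}"

lemma cell_borel [measurable]: "cell k y j \<in> sets borel"
  unfolding cell_def by measurable

text \<open>Comparison with the neighbours is enough: every earlier facility is at most
  \<open>y (j - 1)\<close>, so lying right of the midpoint with that neighbour beats all of them;
  likewise on the other side.\<close>

lemma fdist_cell:
  assumes "1 \<le> k" "mono_on {1..k} y" "j \<in> {1..k}" "x \<in> cell k y j"
  shows "fdist k y x = \<bar>x - y j\<bar>"
proof (rule antisym)
  obtain i where i: "i \<in> {1..k}" "fdist k y x = \<bar>x - y i\<bar>"
    using fdist_attained[OF assms(1)] .
  consider "i = j" | "i < j" | "j < i" by linarith
  then have "\<bar>x - y j\<bar> \<le> \<bar>x - y i\<bar>"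
  proof cases
    case 2
    then have "y i \<le> y (j - 1)" "y (j - 1) \<le> y j" "j \<noteq> 1"
      using i assms(3) by (auto intro!: mono_onD[OF assms(2)])
    then show ?thesis using assms(4) by (auto simp: cell_def abs_if field_simps)
  next
    case 3
    then have "y (j + 1) \<le> y i" "y j \<le> y (j + 1)" "j \<noteq> k"
      using i assms(3) by (auto intro!: mono_onD[OF assms(2)])
    then show ?thesis using assms(4) by (auto simp: cell_def abs_if field_simps)
  qed simp
  then show "\<bar>x - y j\<bar> \<le> fdist k y x" using i by simp
qed (rule fdist_le[OF assms(3)])

text \<open>A point outside the cell lies across a midpoint, or on the left one, and there the
  neighbour on that side is at least as close. So facility \<open>j\<close> can be moved freely
  without a loss at such points, which both variations below exploit.\<close>

lemma fdist_not_cell: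
  assumes "1 \<le> k" "mono_on {1..k} y" "j \<in> {1..k}" "x \<notin> cell k y j"
  shows "\<exists>i\<in>{1..k} - {j}. fdist k y x = \<bar>x - y i\<bar>"
proof -
  obtain i where i: "i \<in> {1..k}" "fdist k y x = \<bar>x - y i\<bar>"
    using fdist_attained[OF assms(1)] .
  show ?thesis
  proof (cases "i = j")
    case True
    consider "j \<noteq> 1" "x \<le> (y (j - 1) + y j) / 2" | "j \<noteq> k" "(y j + y (j + 1)) / 2 < x"
      using assms(4) by (auto simp: cell_def)
    then obtain l where l: "l \<in> {1..k}" "l \<noteq> j" "\<bar>x - y l\<bar> \<le> \<bar>x - y j\<bar>"
    proof cases
      case 1
      then have "y (j - 1) \<le> y j"
        using assms(3) by (intro mono_onD[OF assms(2)]) auto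
      then show ?thesis using 1 assms(3) by (intro that[of "j - 1"]) (auto simp: abs_if field_simps)
    next
      case 2
      then have "y j \<le> y (j + 1)"
        using assms(3) by (intro mono_onD[OF assms(2)]) auto
      then show ?thesis using 2 assms(3) by (intro that[of "j + 1"]) (auto simp: abs_if field_simps)
    qed
    then show ?thesis using i True fdist_le[OF l(1), of y x] by (intro bexI[of _ l]) auto
  qed (use i in auto)
qed

context real_distribution
begin

lemma prob_greaterThanAtMost: "a \<le> b \<Longrightarrow> prob {a<..b} = cdf M b - cdf M a"
  using cdf_diff_eq[of a b] by (cases "a = b") auto

lemma prob_greaterThan: "prob {a<..} = 1 - cdf M a"
proof -
  have "{a<..} = space M - {..a}" by auto
  then show ?thesis using prob_compl[of "{..a}"] by (simp add: cdf_def)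
qed

lemma cell_median:
  assumes k: "1 \<le> k" and int: "integrable M (\<lambda>x. \<bar>x\<bar>)"
    and opt: "\<And>z. mean_fdist k y \<le> mean_fdist k z"
    and mono: "mono_on {1..k} y" and j: "j \<in> {1..k}"
    and cont: "isCont (cdf M) (y j)"
  shows "2 * prob (cell k y j \<inter> {..y j}) = prob (cell k y j)"
proof -
  let ?C = "cell k y j" and ?t = "y j"
  have int': "integrable M (\<lambda>x. x)" using int by (simp add: integrable_abs_iff)
  have diff_int: "integrable M (\<lambda>x. (\<bar>x - s\<bar> - \<bar>x - ?t\<bar>) * indicator ?C x)" for s
    using int' by (intro integrable_real_mult_indicator) auto
  have move: "0 \<le> (\<integral>x. (\<bar>x - s\<bar> - \<bar>x - ?t\<bar>) * indicator ?C x \<partial>M)" for s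
  proof -
    have "mean_fdist k (y(j := s))
        \<le> (\<integral>x. fdist k y x + (\<bar>x - s\<bar> - \<bar>x - ?t\<bar>) * indicator ?C x \<partial>M)"
      unfolding mean_fdist_def
    proof (rule integral_mono)
      fix x
      show "fdist k (y(j := s)) x \<le> fdist k y x + (\<bar>x - s\<bar> - \<bar>x - ?t\<bar>) * indicator ?C x"
      proof (cases "x \<in> ?C")
        case True
        then show ?thesis
          using fdist_cell[OF k mono j] fdist_le[OF j, of "y(j := s)" x] by simp
      next
        case False
        then obtain i where "i \<in> {1..k}" "i \<noteq> j" "fdist k y x = \<bar>x - y i\<bar>"
          using fdist_not_cell[OF k mono j] by blast
        then show ?thesis using False fdist_le[of i k "y(j := s)" x] by simp
      qed
    qed (intro integrable_fdist k int Bochner_Integration.integrable_add diff_int)+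
    also have "\<dots> = mean_fdist k y + (\<integral>x. (\<bar>x - s\<bar> - \<bar>x - ?t\<bar>) * indicator ?C x \<partial>M)"
      unfolding mean_fdist_def
      by (intro Bochner_Integration.integral_add integrable_fdist k int diff_int)
    finally show ?thesis using opt[of "y(j := s)"] by linarith
  qed
  have ind_int: "integrable M (\<lambda>x. c * (2 * indicator (?C \<inter> {..s}) x - indicator ?C x) :: real)" for c s
    by (intro integrable_mult_right Bochner_Integration.integrable_diff integrable_real_indicator)
      (auto simp: emeasure_eq_measure)
  have ind_eq: "(\<integral>x. c * (2 * indicator (?C \<inter> {..s}) x - indicator ?C x) \<partial>M)
      = c * (2 * prob (?C \<inter> {..s}) - prob ?C)" for c s :: real
    by (simp add: emeasure_eq_measure)
  \<comment> \<open>For \<open>s\<close> right of \<open>?t\<close>, the distance grows by at most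
    \<open>s - ?t\<close> at points up to \<open>s\<close> and drops by exactly
    \<open>s - ?t\<close> beyond \<open>s\<close>.\<close>
  have right: "prob ?C \<le> 2 * prob (?C \<inter> {..s})" if "?t < s" for s
  proof -
    have "0 \<le> (\<integral>x. (\<bar>x - s\<bar> - \<bar>x - ?t\<bar>) * indicator ?C x \<partial>M)" by (rule move)
    also have "\<dots> \<le> (\<integral>x. (s - ?t) * (2 * indicator (?C \<inter> {..s}) x - indicator ?C x) \<partial>M)"
      using that by (intro integral_mono diff_int ind_int) (auto simp: indicator_def abs_if)
    finally show ?thesis using that unfolding ind_eq by (simp add: zero_le_mult_iff)
  qed
  \<comment> \<open>Here \<open>s - ?t\<close> is negative, so dividing by it reverses the
    inequality.\<close>
  have left: "2 * prob (?C \<inter> {..s}) \<le> prob ?C" if "s < ?t" for s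
  proof -
    have "0 \<le> (\<integral>x. (\<bar>x - s\<bar> - \<bar>x - ?t\<bar>) * indicator ?C x \<partial>M)" by (rule move)
    also have "\<dots> \<le> (\<integral>x. (s - ?t) * (2 * indicator (?C \<inter> {..s}) x - indicator ?C x) \<partial>M)"
      using that by (intro integral_mono diff_int ind_int) (auto simp: indicator_def abs_if)
    finally show ?thesis using that unfolding ind_eq by (simp add: zero_le_mult_iff)
  qed
  have step: "prob (?C \<inter> {..b}) \<le> prob (?C \<inter> {..a}) + (cdf M b - cdf M a)" if "a \<le> b" for a b
  proof -
    have "prob (?C \<inter> {..b}) \<le> prob ((?C \<inter> {..a}) \<union> {a<..b})"
      by (intro finite_measure_mono) auto
    also have "\<dots> \<le> prob (?C \<inter> {..a}) + prob {a<..b}"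
      by (intro measure_Un_le) auto
    finally show ?thesis using prob_greaterThanAtMost[OF that] by simp
  qed
  have lim: "(cdf M \<longlongrightarrow> cdf M ?t) (at_right ?t)" "(cdf M \<longlongrightarrow> cdf M ?t) (at_left ?t)"
    using cont by (auto simp: isCont_def filterlim_at_split)
  \<comment> \<open>The vanishing difference is kept so that the claim is literally the limit of the
    bounds at \<open>s\<close>.\<close>
  have "prob ?C \<le> 2 * (prob (?C \<inter> {..?t}) + (cdf M ?t - cdf M ?t))"
  proof (rule tendsto_lowerbound)
    show "((\<lambda>s. 2 * (prob (?C \<inter> {..?t}) + (cdf M s - cdf M ?t)))
        \<longlongrightarrow> 2 * (prob (?C \<inter> {..?t}) + (cdf M ?t - cdf M ?t))) (at_right ?t)"
      by (intro tendsto_intros lim)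
    show "\<forall>\<^sub>F s in at_right ?t. prob ?C \<le> 2 * (prob (?C \<inter> {..?t}) + (cdf M s - cdf M ?t))"
    proof (rule eventually_at_rightI[of _ "?t + 1"])
      fix s assume "s \<in> {?t<..<?t + 1}"
      then show "prob ?C \<le> 2 * (prob (?C \<inter> {..?t}) + (cdf M s - cdf M ?t))"
        using right[of s] step[of ?t s] by simp
    qed simp
  qed simp
  moreover have "2 * (prob (?C \<inter> {..?t}) - (cdf M ?t - cdf M ?t)) \<le> prob ?C"
  proof (rule tendsto_upperbound)
    show "((\<lambda>s. 2 * (prob (?C \<inter> {..?t}) - (cdf M ?t - cdf M s)))
        \<longlongrightarrow> 2 * (prob (?C \<inter> {..?t}) - (cdf M ?t - cdf M ?t))) (at_left ?t)"
      by (intro tendsto_intros lim)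
    show "\<forall>\<^sub>F s in at_left ?t. 2 * (prob (?C \<inter> {..?t}) - (cdf M ?t - cdf M s)) \<le> prob ?C"
    proof (rule eventually_at_leftI[of "?t - 1"])
      fix s assume "s \<in> {?t - 1<..<?t}"
      then show "2 * (prob (?C \<inter> {..?t}) - (cdf M ?t - cdf M s)) \<le> prob ?C"
        using left[of s] step[of s ?t] by simp
    qed simp
  qed simp
  ultimately show ?thesis by simp
qed

text \<open>If the cell of \<open>y j\<close> were null, \<open>y j\<close> could be moved to a fresh point of \<open>S\<close>,
  which strictly decreases the mean distance.\<close>
lemma prob_cell_pos:
  assumes k: "1 \<le> k" and int: "integrable M (\<lambda>x. \<bar>x\<bar>)"
    and opt: "\<And>z. mean_fdist k y \<le> mean_fdist k z"
    and mono: "mono_on {1..k} y" and j: "j \<in> {1..k}"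
    and S: "open S" "S \<noteq> {}"
    and charged: "\<And>U. open U \<Longrightarrow> U \<noteq> {} \<Longrightarrow> U \<subseteq> S \<Longrightarrow> prob U \<noteq> 0"
  shows "0 < prob (cell k y j)"
proof (rule ccontr)
  assume "\<not> 0 < prob (cell k y j)"
  then have "prob (cell k y j) = 0" using measure_nonneg[of M "cell k y j"] by linarith
  then have null: "AE x in M. x \<notin> cell k y j"
    by (intro AE_I[of _ _ "cell k y j"]) (auto simp: emeasure_eq_measure)
  have "infinite S" using S open_not_negligible negligible_finite by blast
  then obtain t where t: "t \<in> S" "t \<notin> y ` {1..k}"
    by (meson finite_atLeastAtMost finite_imageI rev_finite_subset subsetI)
  let ?y = "y(j := t)"
  have le: "AE x in M. fdist k ?y x \<le> fdist k y x"
    using null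
  proof eventually_elim
    case (elim x)
    then obtain i where "i \<in> {1..k}" "i \<noteq> j" "fdist k y x = \<bar>x - y i\<bar>"
      using fdist_not_cell[OF k mono j] by blast
    then show ?case using fdist_le[of i k ?y x] by simp
  qed
  have di: "integrable M (\<lambda>x. fdist k y x - fdist k ?y x)"
    by (intro Bochner_Integration.integrable_diff integrable_fdist k int)
  have "(\<integral>x. fdist k y x - fdist k ?y x \<partial>M) = mean_fdist k y - mean_fdist k ?y"
    unfolding mean_fdist_def by (intro Bochner_Integration.integral_diff integrable_fdist k int)
  then have "(\<integral>x. fdist k y x - fdist k ?y x \<partial>M) \<le> 0" using opt[of ?y] by simp
  moreover have "0 \<le> (\<integral>x. fdist k y x - fdist k ?y x \<partial>M)"
    using le by (intro integral_nonneg_AE) auto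
  ultimately have "(\<integral>x. fdist k y x - fdist k ?y x \<partial>M) = 0" by simp
  then have eq: "AE x in M. fdist k y x - fdist k ?y x = 0"
    using le by (subst (asm) integral_nonneg_eq_0_iff_AE[OF di]) auto
  \<comment> \<open>Within distance \<open>r\<close> of \<open>t\<close>, the Lipschitz bound keeps
    the old distance above \<open>r\<close>, whereas the new one is below \<open>r\<close>.\<close>
  define r where "r = fdist k y t / 2"
  have r: "0 < r"
  proof -
    obtain i where "i \<in> {1..k}" "fdist k y t = \<bar>t - y i\<bar>" using fdist_attained[OF k] .
    then show ?thesis using t(2) by (auto simp: r_def)
  qed
  define U where "U = S \<inter> ball t r"
  have "AE x in M. x \<notin> U"
    using eq
  proof eventually_elim
    case (elim x)
    show ?case
    proof
      assume "x \<in> U"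
      then have "\<bar>x - t\<bar> < r" by (auto simp: U_def dist_real_def)
      moreover have "fdist k ?y x \<le> \<bar>x - t\<bar>" using fdist_le[OF j, of ?y x] by simp
      moreover have "\<bar>fdist k y x - fdist k y t\<bar> \<le> \<bar>x - t\<bar>" by (rule fdist_lipschitz[OF k])
      ultimately show False using elim unfolding r_def by linarith
    qed
  qed
  then have "prob U = 0"
    using S by (subst prob_eq_0) (auto simp: U_def)
  moreover have "open U" "U \<noteq> {}" "U \<subseteq> S" using S t r by (auto simp: U_def)
  ultimately show False using charged by blast
qed

lemma prob_cell:
  assumes "mono_on {1..k} y" "j \<in> {1..k}"
  shows "prob (cell k y j) = (if j = k then 1 else cdf M ((y j + y (j + 1)) / 2))
    - (if j = 1 then 0 else cdf M ((y (j - 1) + y j) / 2))"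
proof -
  have "y (j - 1) \<le> y j" if "j \<noteq> 1"
    using assms that by (intro mono_onD[OF assms(1)]) auto
  moreover have "y j \<le> y (j + 1)" if "j \<noteq> k"
    using assms that by (intro mono_onD[OF assms(1)]) auto
  moreover have "cell k y j = (if j = k then UNIV else {..(y j + y (j + 1)) / 2})
      \<inter> (if j = 1 then UNIV else {(y (j - 1) + y j) / 2<..})"
    by (auto simp: cell_def)
  moreover have "{..b} \<inter> {a<..} = {a<..b}" for a b :: real by auto
  moreover have "prob UNIV = 1" using prob_space by simp
  ultimately show ?thesis
    by (auto simp: prob_greaterThanAtMost prob_greaterThan cdf_def2[symmetric])
qed

lemma prob_cell_atMost:
  assumes "mono_on {1..k} y" "j \<in> {1..k}"
  shows "prob (cell k y j \<inter> {..y j}) = cdf M (y j)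
    - (if j = 1 then 0 else cdf M ((y (j - 1) + y j) / 2))"
proof -
  have 1: "y (j - 1) \<le> y j" if "j \<noteq> 1"
    using assms that by (intro mono_onD[OF assms(1)]) auto
  have 2: "j = k \<or> y j \<le> (y j + y (j + 1)) / 2"
    using assms mono_onD[OF assms(1), of j "j + 1"] by force
  have "cell k y j \<inter> {..y j} = (if j = 1 then {..y j} else {(y (j - 1) + y j) / 2<..y j})"
    using 2 by (auto simp: cell_def)
  with 1 show ?thesis by (simp add: prob_greaterThanAtMost cdf_def2[symmetric])
qed

end

section \<open>Consequences of the standing assumptions\<close>

lemma standing_assumptions_real_distribution:
  assumes "standing_assumptions \<mu>"
  shows "real_distribution \<mu>"
  using assms unfolding standing_assumptions_def real_distribution_def real_distribution_axioms_def
  by auto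

lemma standing_assumptions_atomless:
  assumes "standing_assumptions \<mu>"
  shows "measure \<mu> {x} = 0"
proof -
  obtain \<rho> where [measurable]: "\<rho> \<in> borel_measurable borel"
    and \<mu>: "\<mu> = density lborel (\<lambda>x. ennreal (\<rho> x))"
    using assms unfolding standing_assumptions_def by blast
  have "AE z in lborel. z \<noteq> x" by (rule AE_lborel_singleton)
  then have "AE z in \<mu>. z \<noteq> x" unfolding \<mu> by (subst AE_density) (auto elim!: eventually_mono)
  then have "AE z in \<mu>. z \<notin> {x}" by simp
  then have "{x} \<in> null_sets \<mu>" by (subst (asm) AE_iff_null_sets[symmetric]) (auto simp: \<mu>)
  then show ?thesis by (simp add: measure_def null_sets_def)
qed

text \<open>The set is the interior of the support interval. A point outside that interior has the
  whole interval on one side, so the c.d.f. there is 0 or 1; this gives the last property.\<close>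

lemma standing_assumptions_support:
  assumes "standing_assumptions \<mu>"
  obtains S where "open S" "S \<noteq> {}"
    "\<And>U. open U \<Longrightarrow> U \<noteq> {} \<Longrightarrow> U \<subseteq> S \<Longrightarrow> measure \<mu> U \<noteq> 0"
    "\<And>x. 0 < cdf \<mu> x \<Longrightarrow> cdf \<mu> x < 1 \<Longrightarrow> x \<in> S"
proof -
  interpret real_distribution \<mu> by (rule standing_assumptions_real_distribution[OF assms])
  obtain \<rho> I where [measurable]: "\<rho> \<in> borel_measurable borel"
    and \<mu>: "\<mu> = density lborel (\<lambda>x. ennreal (\<rho> x))"
    and I: "is_interval I" "closed I" "interior I \<noteq> {}"
    and out: "\<And>x. x \<notin> I \<Longrightarrow> \<rho> x = 0" and pos: "\<And>x. x \<in> interior I \<Longrightarrow> 0 < \<rho> x"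
    using assms unfolding standing_assumptions_def by blast
  have charged: "prob U \<noteq> 0" if U: "open U" "U \<noteq> {}" "U \<subseteq> interior I" for U
  proof
    assume "prob U = 0"
    then have "AE x in \<mu>. x \<notin> U" using U(1) by (subst (asm) prob_eq_0) auto
    then have "AE x in lborel. 0 < ennreal (\<rho> x) \<longrightarrow> x \<notin> U"
      unfolding \<mu> by (subst (asm) AE_density) auto
    then have "AE x in lborel. x \<notin> U"
      by (rule eventually_mono) (use pos U(3) in auto)
    then have "U \<in> null_sets lborel" using U(1) by (subst AE_iff_null_sets) auto
    then have "negligible U"
      using null_sets_completionI[of U lborel] by (simp add: negligible_iff_null_sets)
    then show False using open_not_negligible[OF U(1,2)] by simp
  qed
  have "AE x in \<mu>. x \<in> I"
  proof -
    have "x \<in> I" if "0 < ennreal (\<rho> x)" for x using out[of x] that by force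
    then show ?thesis unfolding \<mu> by (subst AE_density) auto
  qed
  then have I1: "prob I = 1" using I(2) by (subst prob_eq_1) auto
  \<comment> \<open>This carries one-sided inclusions from the interior over to \<open>I\<close>
    itself.\<close>
  have I_closure: "closure (interior I) = I"
    using convex_closure_interior[of I] I by (simp add: is_interval_convex)
  have "x \<in> interior I" if x: "0 < cdf \<mu> x" "cdf \<mu> x < 1" for x
  proof (rule ccontr)
    assume nx: "x \<notin> interior I"
    have "is_interval (interior I)" using I(1) by (simp add: is_interval_convex_1)
    then consider "interior I \<subseteq> {x..}" | "interior I \<subseteq> {..x}"
      using nx unfolding is_interval_1 by (metis atLeast_iff atMost_iff linear subsetI)
    then show False
    proof cases
      case 1
      then have "I \<subseteq> {x..}" using I_closure closure_minimal[of "interior I" "{x..}"] by auto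
      \<comment> \<open>\<open>x\<close> may be the left endpoint of \<open>I\<close>; its singleton
        is split off and is null because \<mu> has no atoms.\<close>
      then have sub: "{..x} \<subseteq> (space \<mu> - I) \<union> {x}" by auto
      have "cdf \<mu> x \<le> prob ((space \<mu> - I) \<union> {x})"
        unfolding cdf_def using I(2) by (intro finite_measure_mono[OF sub]) auto
      also have "\<dots> \<le> prob (space \<mu> - I) + prob {x}"
        using I(2) by (intro measure_Un_le) auto
      also have "\<dots> = 0"
        using prob_compl[of I] I(2) I1 standing_assumptions_atomless[OF assms] by simp
      finally show False using x(1) by simp
    next
      case 2
      then have "I \<subseteq> {..x}" using I_closure closure_minimal[of "interior I" "{..x}"] by auto
      then have "prob I \<le> cdf \<mu> x" unfolding cdf_def by (intro finite_measure_mono) auto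
      then show False using x(2) I1 by simp
    qed
  qed
  then show ?thesis using that[of "interior I"] charged I(3) by auto
qed

subsection \<open>Order statistics and empirical frequencies\<close>

text \<open>For a downward closed \<open>P\<close>, the entries satisfying \<open>P\<close> form an
  initial segment of a sorted list.\<close>

lemma sorted_nth_iff_length_filter:
  assumes "sorted xs" "\<And>a b. a \<le> b \<Longrightarrow> P b \<Longrightarrow> P a" "m < length xs"
  shows "P (xs ! m) \<longleftrightarrow> m < length (filter P xs)"
  using assms(1,3)
proof (induction xs arbitrary: m)
  case (Cons a xs)
  show ?case
  proof (cases "P a")
    case True
    then show ?thesis using Cons by (cases m) auto
  next
    case False
    then have nP: "\<not> P z" if "z \<in> set (a # xs)" for z
      using that Cons.prems(1) assms(2) by auto
    then have "filter P (a # xs) = []" by (simp add: filter_empty_conv)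
    moreover have "\<not> P ((a # xs) ! m)" using Cons.prems(2) by (intro nP nth_mem)
    ultimately show ?thesis by simp
  qed
qed simp

text \<open>Sorting only permutes the sample, so the count can be taken before sorting. A general
  downward closed \<open>P\<close> covers both \<open>z \<le> c\<close> and \<open>z < c\<close>;
  the shift \<open>m + 1\<close> reflects that \<open>order_stat\<close> counts from 1.\<close>

lemma order_stat_iff_card:
  assumes "\<And>a b. a \<le> b \<Longrightarrow> P b \<Longrightarrow> P a" "m < n"
  shows "P (order_stat n x (m + 1)) \<longleftrightarrow> m < card {i. i < n \<and> P (x i)}"
proof -
  let ?xs = "sort (map x [0..<n])"
  have "length (filter P ?xs) = size (filter_mset P (mset ?xs))"
    by (metis mset_filter size_mset)
  also have "\<dots> = length (filter P (map x [0..<n]))"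
    by (simp only: mset_sort flip: mset_filter size_mset)
  also have "\<dots> = card {i. i < n \<and> P (x i)}"
    by (simp add: length_filter_conv_card cong: conj_cong)
  finally show ?thesis
    using sorted_nth_iff_length_filter[of ?xs P m] assms by (simp add: order_stat_def)
qed

lemma order_stat_in:
  assumes "m < n"
  shows "order_stat n x (m + 1) \<in> x ` {..<n}"
proof -
  have "order_stat n x (m + 1) \<in> set (sort (map x [0..<n]))"
    unfolding order_stat_def using assms by (intro nth_mem) simp
  then show ?thesis by auto
qed

definition freq :: "nat \<Rightarrow> real set \<Rightarrow> (nat \<Rightarrow> real) \<Rightarrow> real" where
  "freq n A x = (1 / real n) * (\<Sum>i<n. indicator A (x i))"

lemma card_eq_freq: "0 < n \<Longrightarrow> real (card {i. i < n \<and> x i \<in> A}) = real n * freq n A x"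
proof -
  assume "0 < n"
  have "(\<Sum>i<n. indicator A (x i)) = real (card ({..<n} \<inter> {i. x i \<in> A}))"
    by (simp add: indicator_def sum.If_cases flip: of_bool_def)
  also have "{..<n} \<inter> {i. x i \<in> A} = {i. i < n \<and> x i \<in> A}" by auto
  finally show ?thesis using \<open>0 < n\<close> by (simp add: freq_def)
qed

section \<open>Coordinates and empirical frequencies of an independent sample\<close>

context real_distribution
begin

lemma prob_UNIV [simp]: "prob UNIV = 1"
  using prob_space by simp

abbreviation sample :: "nat \<Rightarrow> (nat \<Rightarrow> real) measure" where
  "sample n \<equiv> PiM {..<n} (\<lambda>_. M)"

lemma prob_space_sample: "prob_space (sample n)"
  by (rule prob_space_PiM) (rule prob_space_axioms)

lemma distr_sample_component:
  assumes "i < n"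
  shows "distr (sample n) M (\<lambda>x. x i) = M"
  using distr_PiM_component[of "{..<n}" "\<lambda>_. M" i] assms prob_space_axioms by simp

lemma measurable_sample_component [measurable]:
  assumes "i < n"
  shows "(\<lambda>x. x i) \<in> measurable (sample n) M"
  using measurable_component_singleton[of i "{..<n}" "\<lambda>_. M"] assms by simp

lemma integrable_sample_component:
  fixes f :: "real \<Rightarrow> real"
  assumes "i < n" "integrable M f"
  shows "integrable (sample n) (\<lambda>x. f (x i))"
  using integrable_distr[OF measurable_sample_component[OF assms(1)], of f] assms
  by (simp add: distr_sample_component)

lemma integral_sample_component:
  fixes f :: "real \<Rightarrow> real"
  assumes "i < n" "f \<in> borel_measurable M"
  shows "(\<integral>x. f (x i) \<partial>sample n) = (\<integral>x. f x \<partial>M)"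
  using integral_distr[OF measurable_sample_component[OF assms(1)] assms(2)]
  by (simp add: distr_sample_component assms)

lemma integrable_sample_mean:
  fixes f :: "real \<Rightarrow> real"
  assumes "integrable M f"
  shows "integrable (sample n) (\<lambda>x. (1 / real n) * (\<Sum>i<n. f (x i)))"
  using assms
  by (intro integrable_mult_right Bochner_Integration.integrable_sum integrable_sample_component) auto

lemma integral_sample_mean:
  fixes f :: "real \<Rightarrow> real"
  assumes "integrable M f" "0 < n"
  shows "(\<integral>x. (1 / real n) * (\<Sum>i<n. f (x i)) \<partial>sample n) = (\<integral>x. f x \<partial>M)"
proof -
  have "(\<integral>x. (1 / real n) * (\<Sum>i<n. f (x i)) \<partial>sample n)
      = (1 / real n) * (\<Sum>i<n. \<integral>x. f (x i) \<partial>sample n)"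
    using assms by (simp add: Bochner_Integration.integral_sum integrable_sample_component)
  also have "\<dots> = (1 / real n) * (\<Sum>i<n. \<integral>x. f x \<partial>M)"
    using assms(1) by (simp add: integral_sample_component)
  finally show ?thesis using assms(2) by simp
qed

lemma
  fixes f :: "real \<Rightarrow> real"
  assumes "i < n" "j < n" "i \<noteq> j" "integrable M f"
  shows integrable_sample_product: "integrable (sample n) (\<lambda>x. f (x i) * f (x j))"
    and integral_sample_product:
      "(\<integral>x. f (x i) * f (x j) \<partial>sample n) = (\<integral>x. f x \<partial>M) * (\<integral>x. f x \<partial>M)"
proof -
  interpret P: product_prob_space "\<lambda>_ :: nat. M" "{..<n}" by unfold_locales
  \<comment> \<open>Padding with the constant 1 turns \<open>f (x i) * f (x j)\<close> into a
    product over all coordinates, to which the product formula for the product measure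
    applies.\<close>
  define g where "g l = (if l = i \<or> l = j then f else (\<lambda>_. 1))" for l
  have g_int: "integrable M (g l)" for l using assms by (simp add: g_def)
  have sub: "(\<Prod>l<n. h l) = h i * h j" if "\<And>l. l \<noteq> i \<Longrightarrow> l \<noteq> j \<Longrightarrow> h l = 1" for h :: "nat \<Rightarrow> real"
  proof -
    have "(\<Prod>l<n. h l) = (\<Prod>l\<in>{i, j}. h l)"
      using assms that by (intro prod.mono_neutral_right) auto
    then show ?thesis using assms by simp
  qed
  have *: "(\<lambda>x. f (x i) * f (x j)) = (\<lambda>x. \<Prod>l<n. g l (x l))"
    by (rule ext, subst sub) (auto simp: g_def)
  show "integrable (sample n) (\<lambda>x. f (x i) * f (x j))"
    unfolding * by (intro P.product_integrable_prod g_int) auto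
  have "(\<integral>x. f (x i) * f (x j) \<partial>sample n) = (\<Prod>l<n. \<integral>x. g l x \<partial>M)"
    unfolding * by (intro P.product_integral_prod g_int) auto
  also have "\<dots> = (\<integral>x. f x \<partial>M) * (\<integral>x. f x \<partial>M)"
    by (subst sub) (auto simp: g_def prob_space)
  finally show "(\<integral>x. f (x i) * f (x j) \<partial>sample n) = (\<integral>x. f x \<partial>M) * (\<integral>x. f x \<partial>M)" .
qed

text \<open>Centred indicators of distinct coordinates are uncorrelated, so only the diagonal of the
  squared sum survives and the variance is at most 1/n. The first absolute moment then follows from
  the second.\<close>

lemma
  assumes A: "A \<in> sets borel" and n: "0 < n"
  shows integrable_freq_dev: "integrable (sample n) (\<lambda>x. \<bar>freq n A x - prob A\<bar>)"
    and expectation_freq_dev: "(\<integral>x. \<bar>freq n A x - prob A\<bar> \<partial>sample n) \<le> 2 / sqrt (real n)"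
proof -
  interpret S: prob_space "sample n" by (rule prob_space_sample)
  define f where "f z = indicator A z - prob A" for z :: real
  have ind: "integrable M (indicator A :: real \<Rightarrow> real)"
    using A by (intro integrable_real_indicator) (auto simp: emeasure_eq_measure)
  have f_int: "integrable M f" unfolding f_def using ind by simp
  have f0: "(\<integral>z. f z \<partial>M) = 0"
    unfolding f_def using ind A by (simp add: prob_space)
  have f_le: "\<bar>f z\<bar> \<le> 1" for z
    using prob_le_1[of A] measure_nonneg[of M A] by (auto simp: f_def indicator_def)
  have f2_le: "f z * f z \<le> 1" for z
    using mult_mono[OF f_le[of z] f_le[of z]] by simp
  have f2_int: "integrable M (\<lambda>z. f z * f z)"
  proof (rule integrable_const_bound[of _ 1])
    show "(\<lambda>z. f z * f z) \<in> borel_measurable M"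
      using f_int by (intro borel_measurable_times borel_measurable_integrable)
    show "AE z in M. norm (f z * f z) \<le> 1"
      using f2_le by (intro AE_I2) simp
  qed
  have dev: "freq n A x - prob A = (1 / real n) * (\<Sum>i<n. f (x i))" for x
    using n by (simp add: freq_def f_def sum_subtractf field_simps)
  show int: "integrable (sample n) (\<lambda>x. \<bar>freq n A x - prob A\<bar>)"
    unfolding dev by (intro integrable_abs integrable_sample_mean f_int)
  have pair_int: "integrable (sample n) (\<lambda>x. f (x i) * f (x j))" if "i < n" "j < n" for i j
  proof (cases "i = j")
    case True
    then show ?thesis using integrable_sample_component[OF that(1) f2_int] by simp
  next
    case False
    then show ?thesis using that f_int by (intro integrable_sample_product)
  qed
  have pair: "(\<integral>x. f (x i) * f (x j) \<partial>sample n) \<le> (if i = j then 1 else 0)"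
    if "i < n" "j < n" for i j
  proof (cases "i = j")
    case True
    have "(\<integral>x. f (x i) * f (x i) \<partial>sample n) = (\<integral>z. f z * f z \<partial>M)"
      using integral_sample_component[OF that(1) borel_measurable_integrable[OF f2_int]] .
    also have "\<dots> \<le> (\<integral>z. 1 \<partial>M)"
      using f2_le by (intro integral_mono f2_int) auto
    finally show ?thesis using True prob_space by simp
  next
    case False
    then show ?thesis using integral_sample_product[OF that False f_int] f0 by simp
  qed
  have sq: "(freq n A x - prob A)\<^sup>2 = (1 / real n)\<^sup>2 * (\<Sum>i<n. \<Sum>j<n. f (x i) * f (x j))" for x
    unfolding dev by (simp add: power2_eq_square sum_product)
  have sq_int: "integrable (sample n) (\<lambda>x. (freq n A x - prob A)\<^sup>2)"
    unfolding sq by (intro integrable_mult_right Bochner_Integration.integrable_sum pair_int) auto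
  have "(\<integral>x. (\<Sum>i<n. \<Sum>j<n. f (x i) * f (x j)) \<partial>sample n)
      = (\<Sum>i<n. \<integral>x. (\<Sum>j<n. f (x i) * f (x j)) \<partial>sample n)"
    by (intro Bochner_Integration.integral_sum Bochner_Integration.integrable_sum pair_int) auto
  also have "\<dots> = (\<Sum>i<n. \<Sum>j<n. \<integral>x. f (x i) * f (x j) \<partial>sample n)"
    by (intro sum.cong refl Bochner_Integration.integral_sum pair_int) auto
  finally have "(\<integral>x. (freq n A x - prob A)\<^sup>2 \<partial>sample n)
      = (1 / real n)\<^sup>2 * (\<Sum>i<n. \<Sum>j<n. \<integral>x. f (x i) * f (x j) \<partial>sample n)"
    unfolding sq by simp
  also have "\<dots> \<le> (1 / real n)\<^sup>2 * (\<Sum>i<n. \<Sum>j<n. if i = j then 1 else 0)"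
    by (intro mult_left_mono sum_mono pair) auto
  also have "\<dots> = 1 / real n"
    using n by (simp add: power2_eq_square)
  finally have var: "(\<integral>x. (freq n A x - prob A)\<^sup>2 \<partial>sample n) \<le> 1 / real n" .
  \<comment> \<open>The weight \<open>sqrt (real n)\<close> balances the two terms: with variance at
    most 1/n, each contributes at most \<open>1 / sqrt (real n)\<close>, hence the constant
    2.\<close>
  have young: "\<bar>u\<bar> \<le> 1 / sqrt (real n) + sqrt (real n) * u\<^sup>2" for u :: real
  proof -
    have "0 \<le> (sqrt (real n) * \<bar>u\<bar> - 1)\<^sup>2 + sqrt (real n) * \<bar>u\<bar>" by simp
    then have "sqrt (real n) * \<bar>u\<bar> \<le> 1 + (sqrt (real n))\<^sup>2 * u\<^sup>2"
      by (simp add: power2_eq_square algebra_simps)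
    then show ?thesis using n by (simp add: field_simps power2_eq_square)
  qed
  have "(\<integral>x. \<bar>freq n A x - prob A\<bar> \<partial>sample n)
      \<le> (\<integral>x. 1 / sqrt (real n) + sqrt (real n) * (freq n A x - prob A)\<^sup>2 \<partial>sample n)"
    using young by (intro integral_mono int) (auto intro!: integrable_mult_right sq_int)
  also have "\<dots> = 1 / sqrt (real n) + sqrt (real n) * (\<integral>x. (freq n A x - prob A)\<^sup>2 \<partial>sample n)"
    using sq_int S.prob_space by simp
  also have "\<dots> \<le> 1 / sqrt (real n) + sqrt (real n) * (1 / real n)"
    using var by (intro add_left_mono mult_left_mono) auto
  also have "\<dots> = 2 / sqrt (real n)"
    using n by (simp add: field_simps)
  finally show "(\<integral>x. \<bar>freq n A x - prob A\<bar> \<partial>sample n) \<le> 2 / sqrt (real n)" .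
qed

lemma freq_dev_tendsto_0:
  assumes "A \<in> sets borel"
  shows "(\<lambda>n. \<integral>x. \<bar>freq n A x - prob A\<bar> \<partial>sample n) \<longlonglongrightarrow> 0"
proof (rule tendsto_sandwich[where f = "\<lambda>_. 0" and h = "\<lambda>n. 2 / sqrt (real n)"])
  show "\<forall>\<^sub>F n in sequentially. (\<integral>x. \<bar>freq n A x - prob A\<bar> \<partial>sample n) \<le> 2 / sqrt (real n)"
    using eventually_gt_at_top[of 0] by eventually_elim (rule expectation_freq_dev[OF assms])
  show "(\<lambda>n. 2 / sqrt (real n)) \<longlonglongrightarrow> 0"
    by (intro tendsto_divide_0[OF tendsto_const] filterlim_at_top_imp_at_infinity
        filterlim_compose[OF sqrt_at_top filterlim_real_sequentially])
  show "\<forall>\<^sub>F n in sequentially. 0 \<le> (\<integral>x. \<bar>freq n A x - prob A\<bar> \<partial>sample n)"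
    by (intro always_eventually allI Bochner_Integration.integral_nonneg) simp
qed simp

lemma borel_measurable_order_stat [measurable]:
  assumes "m < n"
  shows "(\<lambda>x. order_stat n x (m + 1)) \<in> borel_measurable (sample n)"
  unfolding borel_measurable_iff_le
proof
  fix t
  have "order_stat n x (m + 1) \<le> t \<longleftrightarrow> real m < real n * freq n {..t} x" for x
  proof -
    have "order_stat n x (m + 1) \<le> t \<longleftrightarrow> m < card {i. i < n \<and> x i \<in> {..t}}"
      using order_stat_iff_card[of "\<lambda>z. z \<le> t" m n x] assms by simp
    also have "\<dots> \<longleftrightarrow> real m < real (card {i. i < n \<and> x i \<in> {..t}})" by simp
    also have "\<dots> \<longleftrightarrow> real m < real n * freq n {..t} x"
      using assms by (subst card_eq_freq) auto
    finally show ?thesis .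
  qed
  then have "{x \<in> space (sample n). order_stat n x (m + 1) \<le> t}
      = {x \<in> space (sample n). real m < real n * freq n {..t} x}"
    by simp
  also have "\<dots> \<in> sets (sample n)"
    unfolding freq_def by measurable
  finally show "{x \<in> space (sample n). order_stat n x (m + 1) \<le> t} \<in> sets (sample n)" .
qed

lemma integrable_order_stat:
  assumes "m < n" "integrable M (\<lambda>x. \<bar>x\<bar>)"
  shows "integrable (sample n) (\<lambda>x. order_stat n x (m + 1))"
proof (rule Bochner_Integration.integrable_bound)
  show "integrable (sample n) (\<lambda>x. \<Sum>i<n. \<bar>x i\<bar>)"
    using assms by (intro Bochner_Integration.integrable_sum integrable_sample_component) auto
  show "AE x in sample n. norm (order_stat n x (m + 1)) \<le> norm (\<Sum>i<n. \<bar>x i\<bar>)"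
  proof (rule AE_I2)
    fix x
    obtain i where "i < n" "order_stat n x (m + 1) = x i" using order_stat_in[OF assms(1), of x] by auto
    moreover from this have "\<bar>x i\<bar> \<le> (\<Sum>i<n. \<bar>x i\<bar>)" by (intro member_le_sum) auto
    ultimately show "norm (order_stat n x (m + 1)) \<le> norm (\<Sum>i<n. \<bar>x i\<bar>)" by simp
  qed
qed (rule borel_measurable_order_stat[OF assms(1)])

end

text \<open>The mechanism places facilities that depend on the sample, so both the point and the
  facilities vary with the argument.\<close>

lemma borel_measurable_fdist_param:
  assumes "1 \<le> k" "f \<in> borel_measurable N" "\<And>j. j \<in> {1..k} \<Longrightarrow> (\<lambda>x. g x j) \<in> borel_measurable N"
  shows "(\<lambda>x. fdist k (g x) (f x)) \<in> borel_measurable N"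
proof -
  have "(\<lambda>x. INF j\<in>{1..k}. \<bar>f x - g x j\<bar>) \<in> borel_measurable N"
    using assms by (intro borel_measurable_cINF_real borel_measurable_abs borel_measurable_diff) auto
  then show ?thesis
    using assms(1) by (simp add: fdist_def cInf_eq_Min)
qed

text \<open>An order statistic beyond \<open>q \<plusminus> \<delta>\<close> forces a deviation of an empirical frequency; one beyond
  \<open>\<plusminus>K\<close> has a positive fraction of the sample beyond it, so the tail mean controls the excess.\<close>
lemma order_stat_deviation:
  fixes v q \<delta> K p1 p2 :: real
  assumes v: "0 < v" "v < 1" and n: "2 \<le> n" and K: "\<bar>q\<bar> \<le> K" and \<delta>: "0 < \<delta>"
    and p: "p2 < v" "v < p1" and n2: "2 / real n \<le> v - p2"
  shows "\<bar>order_stat n x (nat \<lfloor>(real n - 1) * v\<rfloor> + 1) - q\<bar>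
    \<le> \<delta> + 2 * K * (\<bar>freq n {..q + \<delta>} x - p1\<bar> / (p1 - v) + 2 * \<bar>freq n {..<q - \<delta>} x - p2\<bar> / (v - p2))
      + (1 / (1 - v) + 2 / v) * ((1 / real n) * (\<Sum>i<n. max 0 (\<bar>x i\<bar> - K)))"
proof -
  define m where "m = nat \<lfloor>(real n - 1) * v\<rfloor>"
  define t where "t = order_stat n x (m + 1)"
  define \<tau> where "\<tau> = (1 / real n) * (\<Sum>i<n. max 0 (\<bar>x i\<bar> - K))"
  have nn: "0 \<le> (real n - 1) * v" using n v by simp
  have m1: "real m \<le> (real n - 1) * v" and m2: "(real n - 1) * v < real m + 1"
    unfolding m_def using nn by linarith+
  have "(real n - 1) * v \<le> real n - 1" using mult_left_mono[of v 1 "real n - 1"] v n by simp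
  then have mn: "m < n" using m1 by linarith
  have m3: "real m \<le> real n * v" using m1 v by (simp add: algebra_simps)
  \<comment> \<open>Here \<open>2 \<le> n\<close> enters: replacing \<open>real n\<close> by
    \<open>real n - 1\<close> loses \<open>v\<close>, at most half of \<open>real n * v\<close>.
    This is the origin of the 2 in \<open>2 / v\<close>.\<close>
  have m4: "real n * v / 2 \<le> real m + 1"
  proof -
    have "2 * v \<le> real n * v" using n v by (intro mult_right_mono) auto
    then show ?thesis using m2 by (simp add: algebra_simps)
  qed
  have \<tau>0: "0 \<le> \<tau>" unfolding \<tau>_def by (intro mult_nonneg_nonneg sum_nonneg) auto
  have \<tau>n: "real n * \<tau> = (\<Sum>i<n. max 0 (\<bar>x i\<bar> - K))" using n by (simp add: \<tau>_def)
  have up: "t - K \<le> \<tau> / (1 - v)"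
  proof (cases "t \<le> K")
    case True
    then show ?thesis using \<tau>0 v by (simp add: order_trans[of _ 0])
  next
    case False
    let ?B = "{i. i < n \<and> t \<le> x i}"
    have "\<not> m < card {i. i < n \<and> x i < t}"
      using order_stat_iff_card[of "\<lambda>z. z < t" m n x] mn by (simp add: t_def)
    moreover have "card ?B + card {i. i < n \<and> x i < t} = n"
      by (subst card_Un_disjoint[symmetric]) (auto intro!: arg_cong[of _ "{..<n}" card, simplified])
    ultimately have "real n * (1 - v) \<le> real (card ?B)" using m3 by (simp add: algebra_simps)
    then have "real n * (1 - v) * (t - K) \<le> real (card ?B) * (t - K)"
      using False by (intro mult_right_mono) auto
    also have "\<dots> = (\<Sum>i\<in>?B. t - K)" by simp
    also have "\<dots> \<le> (\<Sum>i\<in>?B. max 0 (\<bar>x i\<bar> - K))" by (intro sum_mono) auto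
    also have "\<dots> \<le> (\<Sum>i<n. max 0 (\<bar>x i\<bar> - K))" by (intro sum_mono2) auto
    finally have "real n * ((1 - v) * (t - K)) \<le> real n * \<tau>" unfolding \<tau>n by (simp add: mult.assoc)
    then have "(1 - v) * (t - K) \<le> \<tau>" using n by simp
    then show ?thesis using v by (simp add: field_simps)
  qed
  have down: "- K - t \<le> 2 * \<tau> / v"
  proof (cases "- K \<le> t")
    case True
    then show ?thesis using \<tau>0 v by (simp add: order_trans[of _ 0])
  next
    case False
    let ?B = "{i. i < n \<and> x i \<le> t}"
    have "m < card ?B"
      using order_stat_iff_card[of "\<lambda>z. z \<le> t" m n x] mn by (simp add: t_def)
    then have "real n * v / 2 \<le> real (card ?B)" using m4 by linarith
    then have "real n * v / 2 * (- K - t) \<le> real (card ?B) * (- K - t)"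
      using False by (intro mult_right_mono) auto
    also have "\<dots> = (\<Sum>i\<in>?B. - K - t)" by simp
    also have "\<dots> \<le> (\<Sum>i\<in>?B. max 0 (\<bar>x i\<bar> - K))" by (intro sum_mono) auto
    also have "\<dots> \<le> (\<Sum>i<n. max 0 (\<bar>x i\<bar> - K))" by (intro sum_mono2) auto
    finally have "real n * (v / 2 * (- K - t)) \<le> real n * \<tau>" unfolding \<tau>n by (simp add: mult.assoc)
    then have "v / 2 * (- K - t) \<le> \<tau>" using n by (simp only: mult_le_cancel_left_pos)
    then show ?thesis using v by (simp add: field_simps)
  qed
  define D1 where "D1 = \<bar>freq n {..q + \<delta>} x - p1\<bar> / (p1 - v)"
  define D2 where "D2 = 2 * \<bar>freq n {..<q - \<delta>} x - p2\<bar> / (v - p2)"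
  have D0: "0 \<le> D1" "0 \<le> D2" using p by (auto simp: D1_def D2_def)
  have KD: "0 \<le> 2 * K * D1" "0 \<le> 2 * K * D2" using D0 K by auto
  have up1: "0 \<le> \<tau> / (1 - v)" "0 \<le> 2 * \<tau> / v" using \<tau>0 v by auto
  have D1: "1 \<le> D1" if "q + \<delta> < t"
  proof -
    have "\<not> m < card {i. i < n \<and> x i \<le> q + \<delta>}"
      using order_stat_iff_card[of "\<lambda>z. z \<le> q + \<delta>" m n x] mn that by (simp add: t_def)
    moreover have "real (card {i. i < n \<and> x i \<le> q + \<delta>}) = real n * freq n {..q + \<delta>} x"
      using card_eq_freq[of n x "{..q + \<delta>}"] n by simp
    ultimately have "real n * freq n {..q + \<delta>} x \<le> real n * v" using m3 by linarith
    then have "freq n {..q + \<delta>} x \<le> v" using n by simp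
    then show ?thesis using p by (simp add: D1_def field_simps)
  qed
  have D2: "1 \<le> D2" if "t < q - \<delta>"
  proof -
    have "m < card {i. i < n \<and> x i < q - \<delta>}"
      using order_stat_iff_card[of "\<lambda>z. z < q - \<delta>" m n x] mn that by (simp add: t_def)
    moreover have "real (card {i. i < n \<and> x i < q - \<delta>}) = real n * freq n {..<q - \<delta>} x"
      using card_eq_freq[of n x "{..<q - \<delta>}"] n by simp
    ultimately have "(real n - 1) * v \<le> real n * freq n {..<q - \<delta>} x" using m2 by linarith
    \<comment> \<open>The index costs up to \<open>1 / real n\<close> in the level, for which
      \<open>n2\<close> reserves half of the gap \<open>v - p2\<close>; hence the 2 in
      \<open>D2\<close>.\<close>
    moreover have "real n * v - 1 \<le> (real n - 1) * v" using v by (simp add: algebra_simps)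
    ultimately have "v - 1 / real n \<le> freq n {..<q - \<delta>} x" using n by (simp add: field_simps)
    then have "(v - p2) / 2 \<le> freq n {..<q - \<delta>} x - p2" using n2 by simp
    then show ?thesis using p by (simp add: D2_def field_simps)
  qed
  have K0: "0 \<le> K" using K by linarith
  \<comment> \<open>In the two outer cases the distance is split at \<open>K\<close> or
    \<open>- K\<close>: the inner part is at most \<open>2 * K\<close> and is paid by
    \<open>D1\<close> or \<open>D2\<close>, the outer part by the tail mean.\<close>
  consider "\<bar>t - q\<bar> \<le> \<delta>" | "q + \<delta> < t" | "t < q - \<delta>" by linarith
  then have "\<bar>t - q\<bar> \<le> \<delta> + (2 * K * D1 + 2 * K * D2) + (\<tau> / (1 - v) + 2 * \<tau> / v)"
  proof cases
    case 1
    then show ?thesis using KD up1 by linarith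
  next
    case 2
    then have "2 * K * 1 \<le> 2 * K * D1" using D1 K0 by (intro mult_left_mono) auto
    then show ?thesis using 2 K \<delta> KD up1 up by linarith
  next
    case 3
    then have "2 * K * 1 \<le> 2 * K * D2" using D2 K0 by (intro mult_left_mono) auto
    then show ?thesis using 3 K \<delta> KD up1 down by linarith
  qed
  then show ?thesis
    unfolding D1_def[symmetric] D2_def[symmetric] \<tau>_def[symmetric] m_def[symmetric] t_def[symmetric]
    by (simp add: algebra_simps)
qed

lemma percentile_index_less:
  assumes "0 < n" "0 \<le> v" "v \<le> 1"
  shows "nat \<lfloor>(real n - 1) * v\<rfloor> < n"
proof -
  have "(real n - 1) * v \<le> real n - 1" using mult_left_mono[of v 1 "real n - 1"] assms by simp
  then have "\<lfloor>(real n - 1) * v\<rfloor> < int n" by linarith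
  then show ?thesis using assms(1) by linarith
qed

section \<open>Convergence in mean of sample quantiles\<close>

context real_distribution
begin

lemma tail_mean_tendsto_0:
  assumes "integrable M (\<lambda>x. \<bar>x\<bar>)"
  shows "(\<lambda>K :: nat. \<integral>z. max 0 (\<bar>z\<bar> - real K) \<partial>M) \<longlonglongrightarrow> 0"
proof -
  have "(\<lambda>K :: nat. \<integral>z. max 0 (\<bar>z\<bar> - real K) \<partial>M) \<longlonglongrightarrow> (\<integral>z. 0 \<partial>M)"
  proof (rule integral_dominated_convergence[OF _ _ assms])
    show "AE z in M. (\<lambda>K. max 0 (\<bar>z\<bar> - real K)) \<longlonglongrightarrow> 0"
    proof (rule AE_I2)
      fix z
      have "\<forall>\<^sub>F K in sequentially. max 0 (\<bar>z\<bar> - real K) = 0"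
        using eventually_ge_at_top[of "nat \<lceil>\<bar>z\<bar>\<rceil>"] by eventually_elim linarith
      then show "(\<lambda>K. max 0 (\<bar>z\<bar> - real K)) \<longlonglongrightarrow> 0" by (rule tendsto_eventually)
    qed
  qed auto
  then show ?thesis by simp
qed

text \<open>The pointwise deviation estimate is integrated. Its tail mean has the same expectation
  for every positive \<open>n\<close>, so \<open>\<delta>\<close> and \<open>K\<close> can be fixed
  before \<open>n\<close>; then only the frequency errors depend on \<open>n\<close>, and they
  vanish. Strict increase of the c.d.f. at \<open>q\<close> separates the levels
  \<open>p2 < v < p1\<close>.\<close>

lemma order_stat_quantile_L1:
  assumes int: "integrable M (\<lambda>x. \<bar>x\<bar>)" and q: "0 < cdf M q" "cdf M q < 1"
    and strict: "\<And>\<delta>. 0 < \<delta> \<Longrightarrow> cdf M (q - \<delta>) < cdf M q \<and> cdf M q < cdf M (q + \<delta>)"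
  shows "(\<lambda>n. \<integral>x. \<bar>order_stat n x (nat \<lfloor>(real n - 1) * cdf M q\<rfloor> + 1) - q\<bar> \<partial>sample n) \<longlonglongrightarrow> 0"
    (is "?E \<longlonglongrightarrow> 0")
proof (rule order_tendstoI)
  fix a :: real assume "a < 0"
  moreover have "0 \<le> ?E n" for n by (intro Bochner_Integration.integral_nonneg) simp
  ultimately show "\<forall>\<^sub>F n in sequentially. a < ?E n"
    by (intro always_eventually allI) (meson less_le_trans)
next
  fix \<epsilon> :: real assume \<epsilon>: "0 < \<epsilon>"
  define v where "v = cdf M q"
  define c where "c = 1 / (1 - v) + 2 / v"
  define \<delta> where "\<delta> = \<epsilon> / 4"
  have \<delta>: "0 < \<delta>" using \<epsilon> by (simp add: \<delta>_def)
  have v: "0 < v" "v < 1" using q by (auto simp: v_def)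
  have "(\<lambda>K :: nat. c * (\<integral>z. max 0 (\<bar>z\<bar> - real K) \<partial>M)) \<longlonglongrightarrow> c * 0"
    by (intro tendsto_intros tail_mean_tendsto_0 int)
  then have "\<forall>\<^sub>F K in sequentially. c * (\<integral>z. max 0 (\<bar>z\<bar> - real K) \<partial>M) < \<epsilon> / 4"
    using \<epsilon> by (intro order_tendstoD(2)[where y = "c * 0"]) auto
  then have "\<forall>\<^sub>F K in sequentially. c * (\<integral>z. max 0 (\<bar>z\<bar> - real K) \<partial>M) < \<epsilon> / 4 \<and> nat \<lceil>\<bar>q\<bar>\<rceil> \<le> K"
    using eventually_ge_at_top by (rule eventually_conj)
  then obtain K0 :: nat where K0: "c * (\<integral>z. max 0 (\<bar>z\<bar> - real K0) \<partial>M) < \<epsilon> / 4" "nat \<lceil>\<bar>q\<bar>\<rceil> \<le> K0"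
    by (auto simp: eventually_sequentially)
  define K where "K = real K0"
  have K: "\<bar>q\<bar> \<le> K" "c * (\<integral>z. max 0 (\<bar>z\<bar> - K) \<partial>M) < \<epsilon> / 4" using K0 unfolding K_def by linarith+
  define p1 where "p1 = prob {..q + \<delta>}"
  define p2 where "p2 = prob {..<q - \<delta>}"
  have p1: "v < p1" using strict[OF \<delta>] by (simp add: v_def p1_def cdf_def)
  have "p2 \<le> cdf M (q - \<delta>)" unfolding p2_def cdf_def by (intro finite_measure_mono) auto
  then have p2: "p2 < v" using strict[OF \<delta>] by (simp add: v_def)
  let ?d1 = "\<lambda>n x. \<bar>freq n {..q + \<delta>} x - p1\<bar>" and ?d2 = "\<lambda>n x. \<bar>freq n {..<q - \<delta>} x - p2\<bar>"
  let ?tl = "\<lambda>n x. (1 / real n) * (\<Sum>i<n. max 0 (\<bar>x i\<bar> - K))"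
  let ?T = "\<integral>z. max 0 (\<bar>z\<bar> - K) \<partial>M"
  have tail_int: "integrable M (\<lambda>z. max 0 (\<bar>z\<bar> - K))" using int by auto
  define b where "b n = \<delta> + 2 * K * ((\<integral>x. ?d1 n x \<partial>sample n) / (p1 - v)
      + 2 * (\<integral>x. ?d2 n x \<partial>sample n) / (v - p2)) + c * ?T" for n
  have "(\<lambda>n. \<integral>x. ?d1 n x \<partial>sample n) \<longlonglongrightarrow> 0" "(\<lambda>n. \<integral>x. ?d2 n x \<partial>sample n) \<longlonglongrightarrow> 0"
    unfolding p1_def p2_def by (intro freq_dev_tendsto_0; simp)+
  \<comment> \<open>The limit equals \<open>\<delta> + c * ?T\<close>, and each summand is at most
    \<epsilon>/4.\<close>
  then have "b \<longlonglongrightarrow> \<delta> + 2 * K * (0 / (p1 - v) + 2 * 0 / (v - p2)) + c * ?T"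
    unfolding b_def using p1 p2 by (intro tendsto_intros) auto
  then have ev1: "\<forall>\<^sub>F n in sequentially. b n < \<epsilon>"
    using K(2) \<epsilon> by (elim order_tendstoD(2)) (simp add: \<delta>_def)
  have "(\<lambda>n. 2 / real n) \<longlonglongrightarrow> 0" by (rule lim_const_over_n)
  then have ev2: "\<forall>\<^sub>F n in sequentially. 2 / real n < v - p2"
    using p2 by (elim order_tendstoD(2)) simp
  show "\<forall>\<^sub>F n in sequentially. ?E n < \<epsilon>"
    using ev1 ev2 eventually_ge_at_top[of 2]
  proof eventually_elim
    case (elim n)
    interpret S: prob_space "sample n" by (rule prob_space_sample)
    have n: "0 < n" using elim by simp
    have i1: "integrable (sample n) (?d1 n)" and i2: "integrable (sample n) (?d2 n)"
      unfolding p1_def p2_def using n by (intro integrable_freq_dev; simp)+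
    have i3: "integrable (sample n) (?tl n)" by (rule integrable_sample_mean[OF tail_int])
    have idx: "nat \<lfloor>(real n - 1) * v\<rfloor> < n" using n v by (intro percentile_index_less) auto
    have "?E n \<le> (\<integral>x. \<delta> + 2 * K * (?d1 n x / (p1 - v) + 2 * ?d2 n x / (v - p2)) + c * ?tl n x \<partial>sample n)"
    proof (rule integral_mono)
      show "integrable (sample n) (\<lambda>x. \<bar>order_stat n x (nat \<lfloor>(real n - 1) * cdf M q\<rfloor> + 1) - q\<bar>)"
        unfolding v_def[symmetric]
        by (intro integrable_abs Bochner_Integration.integrable_diff integrable_order_stat idx int) simp
      show "integrable (sample n)
          (\<lambda>x. \<delta> + 2 * K * (?d1 n x / (p1 - v) + 2 * ?d2 n x / (v - p2)) + c * ?tl n x)"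
        by (intro Bochner_Integration.integrable_add integrable_mult_right integrable_divide i1 i2 i3) simp
      fix x
      show "\<bar>order_stat n x (nat \<lfloor>(real n - 1) * cdf M q\<rfloor> + 1) - q\<bar>
          \<le> \<delta> + 2 * K * (?d1 n x / (p1 - v) + 2 * ?d2 n x / (v - p2)) + c * ?tl n x"
        unfolding v_def[symmetric] c_def
        using elim by (intro order_stat_deviation v K \<delta> p1 p2) auto
    qed
    also have "\<dots> = b n"
      unfolding b_def integral_sample_mean[OF tail_int n, symmetric]
      using i1 i2 i3 S.prob_space by (simp del: times_divide_eq_left times_divide_eq_right)
    finally show ?case using elim by simp
  qed
qed

subsection \<open>Convergence of the social costs\<close>

lemma integrable_SC:
  assumes "1 \<le> k" "integrable M (\<lambda>x. \<bar>x\<bar>)"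
  shows "integrable (sample n) (\<lambda>x. SC n k x y)"
  unfolding SC_fdist by (intro integrable_sample_mean integrable_fdist assms)

lemma expectation_SC:
  assumes "1 \<le> k" "integrable M (\<lambda>x. \<bar>x\<bar>)" "0 < n"
  shows "(\<integral>x. SC n k x y \<partial>sample n) = mean_fdist k y"
  unfolding SC_fdist mean_fdist_def by (intro integral_sample_mean integrable_fdist assms)

lemma integrable_SC_opt:
  assumes "1 \<le> k" "integrable M (\<lambda>x. \<bar>x\<bar>)"
  shows "integrable (sample n) (SC_opt n k)"
proof (rule Bochner_Integration.integrable_bound)
  show "integrable (sample n) (\<lambda>x. SC n k x (\<lambda>_. 0))" by (rule integrable_SC[OF assms])
  have "SC_opt n k = (\<lambda>x. INF y \<in> PiE {1..k} (\<lambda>_. \<rat>). SC n k x y)"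
    using SC_opt_rational[OF assms(1)] by blast
  also have "\<dots> \<in> borel_measurable (sample n)"
    using borel_measurable_integrable[OF integrable_SC[OF assms]]
    by (intro borel_measurable_cINF_real countable_PiE countable_rat) auto
  finally show "SC_opt n k \<in> borel_measurable (sample n)" .
  show "AE x in sample n. norm (SC_opt n k x) \<le> norm (SC n k x (\<lambda>_. 0))"
  proof (rule AE_I2)
    fix x
    have "0 \<le> SC_opt n k x" by (intro SC_opt_greatest SC_nonneg assms)
    moreover have "SC_opt n k x \<le> SC n k x (\<lambda>_. 0)" by (rule SC_opt_le[OF assms(1)])
    ultimately show "norm (SC_opt n k x) \<le> norm (SC n k x (\<lambda>_. 0))" by simp
  qed
qed

section \<open>Lower bound for the optimal cost, uniform in the facilities\<close>

lemma simple_quantisation: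
  assumes "integrable M (\<lambda>x. \<bar>x\<bar>)" "0 < \<epsilon>"
  obtains s where "simple_function M s" "integrable M (\<lambda>z. \<bar>z - s z\<bar>)" "(\<integral>z. \<bar>z - s z\<bar> \<partial>M) < \<epsilon>"
proof -
  have "(\<lambda>z. z) \<in> borel_measurable M" by simp
  from borel_measurable_implies_sequence_metric[OF this, of 0] obtain F where
    F: "\<And>i. simple_function M (F i)" "\<And>z. (\<lambda>i. F i z) \<longlonglongrightarrow> z" "\<And>i z. \<bar>F i z\<bar> \<le> 2 * \<bar>z\<bar>"
    by auto
  have [measurable]: "F i \<in> borel_measurable M" for i by (rule borel_measurable_simple_function[OF F(1)])
  \<comment> \<open>On an unbounded support finitely many values cannot approximate uniformly;
    domination by \<open>3 * \<bar>z\<bar>\<close> makes the error small in mean instead.\<close>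
  have bound: "\<bar>z - F i z\<bar> \<le> 3 * \<bar>z\<bar>" for i z using F(3)[of i z] by linarith
  have int3: "integrable M (\<lambda>z. 3 * \<bar>z\<bar>)" using assms(1) by simp
  have "(\<lambda>i. \<integral>z. \<bar>z - F i z\<bar> \<partial>M) \<longlonglongrightarrow> (\<integral>z. 0 \<partial>M)"
  proof (rule integral_dominated_convergence[OF _ _ int3])
    show "AE z in M. (\<lambda>i. \<bar>z - F i z\<bar>) \<longlonglongrightarrow> 0"
    proof (rule AE_I2)
      fix z
      have "(\<lambda>i. \<bar>z - F i z\<bar>) \<longlonglongrightarrow> \<bar>z - z\<bar>" by (intro tendsto_intros F(2))
      then show "(\<lambda>i. \<bar>z - F i z\<bar>) \<longlonglongrightarrow> 0" by simp
    qed
  qed (use bound in auto)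
  then have "\<forall>\<^sub>F i in sequentially. (\<integral>z. \<bar>z - F i z\<bar> \<partial>M) < \<epsilon>"
    using assms(2) by (intro order_tendstoD(2)[where y = 0]) auto
  then obtain i where i: "(\<integral>z. \<bar>z - F i z\<bar> \<partial>M) < \<epsilon>" by (auto simp: eventually_sequentially)
  moreover have "integrable M (\<lambda>z. \<bar>z - F i z\<bar>)"
    using bound by (intro Bochner_Integration.integrable_bound[OF int3]) auto
  ultimately show ?thesis using that F(1) by blast
qed

text \<open>The bound does not depend on \<open>y\<close>: after subtracting \<open>fdist k y 0\<close>, the quantised distance
  function is a combination of finitely many indicators with coefficients at most \<open>\<bar>l\<bar>\<close>.\<close>
lemma mean_fdist_minus_SC_le:
  assumes k: "1 \<le> k" and int: "integrable M (\<lambda>x. \<bar>x\<bar>)" and n: "0 < n"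
    and s: "simple_function M s" "integrable M (\<lambda>z. \<bar>z - s z\<bar>)"
  shows "mean_fdist k y - SC n k x y \<le> (\<integral>z. \<bar>z - s z\<bar> \<partial>M) + (1 / real n) * (\<Sum>i<n. \<bar>x i - s (x i)\<bar>)
    + (\<Sum>l\<in>range s. \<bar>l\<bar> * \<bar>freq n (s -` {l}) x - prob (s -` {l})\<bar>)"
proof -
  have fin: "finite (range s)" and ev: "s -` {l} \<in> events" for l
    using s(1) simple_functionD[OF s(1)] by (auto simp: space_eq_univ)
  define c where "c l = fdist k y l - fdist k y 0" for l
  have c: "\<bar>c l\<bar> \<le> \<bar>l\<bar>" for l using fdist_lipschitz[OF k, of y l 0] by (simp add: c_def)
  define h where "h z = (\<Sum>l\<in>range s. c l * indicator (s -` {l}) z)" for z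
  have h: "h z = fdist k y (s z) - fdist k y 0" for z
  proof -
    have "h z = (\<Sum>l\<in>range s. if l = s z then c l else 0)"
      unfolding h_def by (intro sum.cong) (auto simp: indicator_def)
    then show ?thesis using fin by (simp add: c_def)
  qed
  have hd: "\<bar>fdist k y z - (h z + fdist k y 0)\<bar> \<le> \<bar>z - s z\<bar>" for z
    unfolding h using fdist_lipschitz[OF k, of y z "s z"] by simp
  have ind_int: "integrable M (\<lambda>z. c l * indicator (s -` {l}) z)" for l
    using ev by (intro integrable_mult_right integrable_real_indicator) (auto simp: emeasure_eq_measure)
  have h_int: "integrable M h"
    unfolding h_def by (intro Bochner_Integration.integrable_sum ind_int)
  have h_mean: "(\<integral>z. h z \<partial>M) = (\<Sum>l\<in>range s. c l * prob (s -` {l}))"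
    unfolding h_def using ev by (subst Bochner_Integration.integral_sum[OF ind_int]) simp
  have h_emp: "(1 / real n) * (\<Sum>i<n. h (x i)) = (\<Sum>l\<in>range s. c l * freq n (s -` {l}) x)"
    unfolding h_def freq_def by (subst sum.swap) (simp only: sum_distrib_left mult.left_commute[of "1 / real n"])
  \<comment> \<open>The constant \<open>fdist k y 0\<close> has the same mean under the law and
    under the sample, so it cancels when the bounds 1 and 2 are combined.\<close>
  have "mean_fdist k y \<le> (\<integral>z. h z + fdist k y 0 + \<bar>z - s z\<bar> \<partial>M)"
    unfolding mean_fdist_def
  proof (rule integral_mono)
    fix z show "fdist k y z \<le> h z + fdist k y 0 + \<bar>z - s z\<bar>" using hd[of z] by linarith
  qed (use h_int s(2) integrable_fdist[OF k int] in auto)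
  also have "\<dots> = (\<integral>z. h z \<partial>M) + fdist k y 0 + (\<integral>z. \<bar>z - s z\<bar> \<partial>M)"
    using h_int s(2) prob_space by simp
  finally have 1: "mean_fdist k y \<le> (\<Sum>l\<in>range s. c l * prob (s -` {l})) + fdist k y 0 + (\<integral>z. \<bar>z - s z\<bar> \<partial>M)"
    unfolding h_mean .
  have "(\<Sum>i<n. h (x i) + fdist k y 0 - \<bar>x i - s (x i)\<bar>) \<le> (\<Sum>i<n. fdist k y (x i))"
  proof (rule sum_mono)
    fix i show "h (x i) + fdist k y 0 - \<bar>x i - s (x i)\<bar> \<le> fdist k y (x i)" using hd[of "x i"] by linarith
  qed
  then have "(1 / real n) * (\<Sum>i<n. h (x i) + fdist k y 0 - \<bar>x i - s (x i)\<bar>) \<le> SC n k x y"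
    unfolding SC_fdist by (intro mult_left_mono) auto
  also have "(1 / real n) * (\<Sum>i<n. h (x i) + fdist k y 0 - \<bar>x i - s (x i)\<bar>)
      = (1 / real n) * (\<Sum>i<n. h (x i)) + fdist k y 0 - (1 / real n) * (\<Sum>i<n. \<bar>x i - s (x i)\<bar>)"
    using n by (simp add: sum.distrib sum_subtractf field_simps)
  finally have 2: "(\<Sum>l\<in>range s. c l * freq n (s -` {l}) x) + fdist k y 0
      - (1 / real n) * (\<Sum>i<n. \<bar>x i - s (x i)\<bar>) \<le> SC n k x y"
    unfolding h_emp .
  have "(\<Sum>l\<in>range s. c l * prob (s -` {l})) - (\<Sum>l\<in>range s. c l * freq n (s -` {l}) x)
      = (\<Sum>l\<in>range s. c l * (prob (s -` {l}) - freq n (s -` {l}) x))"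
    by (simp add: sum_subtractf algebra_simps)
  also have "\<dots> \<le> (\<Sum>l\<in>range s. \<bar>l\<bar> * \<bar>freq n (s -` {l}) x - prob (s -` {l})\<bar>)"
  proof (rule sum_mono)
    fix l
    have "c l * (prob (s -` {l}) - freq n (s -` {l}) x) \<le> \<bar>c l\<bar> * \<bar>prob (s -` {l}) - freq n (s -` {l}) x\<bar>"
      by (metis abs_ge_self abs_mult)
    also have "\<dots> \<le> \<bar>l\<bar> * \<bar>prob (s -` {l}) - freq n (s -` {l}) x\<bar>"
      using c by (intro mult_right_mono) auto
    finally show "c l * (prob (s -` {l}) - freq n (s -` {l}) x)
        \<le> \<bar>l\<bar> * \<bar>freq n (s -` {l}) x - prob (s -` {l})\<bar>"
      by (simp add: abs_minus_commute)
  qed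
  finally show ?thesis using 1 2 by linarith
qed

text \<open>The pointwise estimate holds for all facilities at once, so it passes to the infimum
  before expectations are taken. Quantisation is charged twice, for the law and for the sample with
  the same mean; together with the frequency errors this makes three parts of
  \<open>\<epsilon> / 3\<close>.\<close>

lemma expectation_SC_opt_ge:
  assumes k: "1 \<le> k" and int: "integrable M (\<lambda>x. \<bar>x\<bar>)"
    and g: "\<And>y. g \<le> mean_fdist k y" and \<epsilon>: "0 < \<epsilon>"
  shows "\<forall>\<^sub>F n in sequentially. g - \<epsilon> \<le> (\<integral>x. SC_opt n k x \<partial>sample n)"
proof -
  obtain s where s: "simple_function M s" "integrable M (\<lambda>z. \<bar>z - s z\<bar>)"
      and s\<epsilon>: "(\<integral>z. \<bar>z - s z\<bar> \<partial>M) < \<epsilon> / 3"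
    using simple_quantisation[OF int, of "\<epsilon> / 3"] \<epsilon> by auto
  let ?e = "\<integral>z. \<bar>z - s z\<bar> \<partial>M"
  let ?q = "\<lambda>n x. (1 / real n) * (\<Sum>i<n. \<bar>x i - s (x i)\<bar>)"
  let ?d = "\<lambda>n l x. \<bar>freq n (s -` {l}) x - prob (s -` {l})\<bar>"
  have ev: "s -` {l} \<in> sets borel" for l
    using simple_functionD(2)[OF s(1), of "{l}"] by (simp add: space_eq_univ)
  have "(\<lambda>n. \<Sum>l\<in>range s. \<bar>l\<bar> * (\<integral>x. ?d n l x \<partial>sample n)) \<longlonglongrightarrow> (\<Sum>l\<in>range s. \<bar>l\<bar> * 0)"
    by (intro tendsto_intros freq_dev_tendsto_0 ev)
  then have "\<forall>\<^sub>F n in sequentially. (\<Sum>l\<in>range s. \<bar>l\<bar> * (\<integral>x. ?d n l x \<partial>sample n)) < \<epsilon> / 3"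
    using \<epsilon> by (elim order_tendstoD(2)) simp
  then show ?thesis
    using eventually_gt_at_top[of 0]
  proof eventually_elim
    case (elim n)
    interpret S: prob_space "sample n" by (rule prob_space_sample)
    have d_int: "integrable (sample n) (\<lambda>x. \<bar>l\<bar> * ?d n l x)" for l
      using elim(2) by (intro integrable_mult_right integrable_freq_dev ev)
    have q_int: "integrable (sample n) (?q n)" by (rule integrable_sample_mean[OF s(2)])
    let ?U = "\<lambda>x. ?e + ?q n x + (\<Sum>l\<in>range s. \<bar>l\<bar> * ?d n l x)"
    have U_int: "integrable (sample n) ?U"
      by (intro Bochner_Integration.integrable_add Bochner_Integration.integrable_sum q_int d_int) simp
    have "(\<integral>x. ?U x \<partial>sample n) = ?e + (\<integral>x. ?q n x \<partial>sample n)
        + (\<Sum>l\<in>range s. \<integral>x. \<bar>l\<bar> * ?d n l x \<partial>sample n)"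
    proof -
      have "(\<integral>x. ?U x \<partial>sample n) = (\<integral>x. ?e + ?q n x \<partial>sample n)
          + (\<integral>x. (\<Sum>l\<in>range s. \<bar>l\<bar> * ?d n l x) \<partial>sample n)"
        by (intro Bochner_Integration.integral_add Bochner_Integration.integrable_add
            Bochner_Integration.integrable_sum q_int d_int) simp
      also have "(\<integral>x. ?e + ?q n x \<partial>sample n) = (\<integral>x. ?e \<partial>sample n) + (\<integral>x. ?q n x \<partial>sample n)"
        by (intro Bochner_Integration.integral_add q_int) simp
      also have "(\<integral>x. ?e \<partial>sample n) = ?e" using S.prob_space by simp
      also have "(\<integral>x. (\<Sum>l\<in>range s. \<bar>l\<bar> * ?d n l x) \<partial>sample n)
          = (\<Sum>l\<in>range s. \<integral>x. \<bar>l\<bar> * ?d n l x \<partial>sample n)"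
        by (intro Bochner_Integration.integral_sum d_int)
      finally show ?thesis .
    qed
    also have "(\<integral>x. ?q n x \<partial>sample n) = ?e"
      by (rule integral_sample_mean[OF s(2) elim(2)])
    also have "(\<Sum>l\<in>range s. \<integral>x. \<bar>l\<bar> * ?d n l x \<partial>sample n)
        = (\<Sum>l\<in>range s. \<bar>l\<bar> * (\<integral>x. ?d n l x \<partial>sample n))"
      by simp
    finally have U_le: "(\<integral>x. ?U x \<partial>sample n) \<le> \<epsilon>" using elim(1) s\<epsilon> by linarith
    have "g - (\<integral>x. ?U x \<partial>sample n) = (\<integral>x. g - ?U x \<partial>sample n)"
      using S.prob_space by (subst Bochner_Integration.integral_diff[OF _ U_int]) auto
    also have "\<dots> \<le> (\<integral>x. SC_opt n k x \<partial>sample n)"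
    proof (rule integral_mono)
      fix x
      show "g - ?U x \<le> SC_opt n k x"
      proof (rule SC_opt_greatest)
        fix y
        show "g - ?U x \<le> SC n k x y"
          using mean_fdist_minus_SC_le[OF k int elim(2) s, of y x] g[of y] by linarith
      qed
    qed (use U_int integrable_SC_opt[OF k int] in auto)
    finally show ?case using U_le by linarith
  qed
qed

section \<open>Limit of the cost ratio\<close>

lemma mean_fdist_pos:
  assumes k: "1 \<le> k" and int: "integrable M (\<lambda>x. \<bar>x\<bar>)" and atomless: "\<And>x. prob {x} = 0"
  shows "0 < mean_fdist k y"
proof (rule ccontr)
  assume neg: "\<not> 0 < mean_fdist k y"
  have nn: "AE x in M. 0 \<le> fdist k y x" using fdist_nonneg[OF k] by simp
  have "0 \<le> mean_fdist k y" unfolding mean_fdist_def by (rule integral_nonneg_AE[OF nn])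
  with neg have "(\<integral>x. fdist k y x \<partial>M) = 0" by (simp add: mean_fdist_def)
  then have zero: "AE x in M. fdist k y x = 0"
    using integral_nonneg_eq_0_iff_AE[OF integrable_fdist[OF k int] nn] by simp
  \<comment> \<open>A zero mean would put all mass on the finitely many facilities, which are null
    without atoms.\<close>
  have "AE x in M. x \<noteq> y j" for j
  proof -
    have "AE x in M. x \<notin> {y j}" using atomless by (subst prob_eq_0[symmetric]) auto
    then show ?thesis by simp
  qed
  then have "AE x in M. \<forall>j\<in>{1..k}. x \<noteq> y j" by (intro eventually_ball_finite) auto
  with zero have "AE x in M. False"
  proof eventually_elim
    case (elim x)
    obtain j where "j \<in> {1..k}" "fdist k y x = \<bar>x - y j\<bar>" using fdist_attained[OF k] .
    then show ?case using elim by auto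
  qed
  then show False by simp
qed

lemma B_ar_quantiles_tendsto_1:
  assumes k: "1 \<le> k" and int: "integrable M (\<lambda>x. \<bar>x\<bar>)"
    and opt: "\<And>z. mean_fdist k y \<le> mean_fdist k z" and pos: "0 < mean_fdist k y"
    and q: "\<And>j. j \<in> {1..k} \<Longrightarrow> 0 < cdf M (y j) \<and> cdf M (y j) < 1"
    and strict: "\<And>j \<delta>. j \<in> {1..k} \<Longrightarrow> 0 < \<delta> \<Longrightarrow>
      cdf M (y j - \<delta>) < cdf M (y j) \<and> cdf M (y j) < cdf M (y j + \<delta>)"
  shows "(\<lambda>n. B_ar M k n (\<lambda>j. cdf M (y j))) \<longlonglongrightarrow> 1"
proof -
  let ?G = "mean_fdist k y" and ?v = "\<lambda>j. cdf M (y j)"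
  define Opt where "Opt n = (\<integral>x. SC_opt n k x \<partial>sample n)" for n
  define A where "A n = (\<integral>x. SC n k x (PM n ?v x) \<partial>sample n)" for n
  define E where "E n = (\<Sum>j\<in>{1..k}. \<integral>x. \<bar>PM n ?v x j - y j\<bar> \<partial>sample n)" for n
  have Opt_le: "Opt n \<le> ?G" if "0 < n" for n
    unfolding Opt_def expectation_SC[OF k int that, of y, symmetric]
    by (intro integral_mono integrable_SC_opt integrable_SC SC_opt_le k int)
  have Opt_lim: "Opt \<longlonglongrightarrow> ?G"
  proof (rule order_tendstoI)
    fix a assume a: "a < ?G"
    \<comment> \<open>Half of the gap is given away so that the weak inequality for
      \<open>Opt n\<close> still yields a strict one.\<close>
    then have "\<forall>\<^sub>F n in sequentially. ?G - (?G - a) / 2 \<le> Opt n"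
      unfolding Opt_def by (intro expectation_SC_opt_ge k int opt) simp
    then show "\<forall>\<^sub>F n in sequentially. a < Opt n"
    proof eventually_elim
      case (elim n)
      then show ?case using a by argo
    qed
  next
    fix a assume a: "?G < a"
    show "\<forall>\<^sub>F n in sequentially. Opt n < a"
      using eventually_gt_at_top[of 0]
    proof eventually_elim
      case (elim n)
      then show ?case using Opt_le[of n] a by simp
    qed
  qed
  have "(\<lambda>n. \<integral>x. \<bar>PM n ?v x j - y j\<bar> \<partial>sample n) \<longlonglongrightarrow> 0" if "j \<in> {1..k}" for j
    unfolding PM_def using q[OF that] strict[OF that] int by (intro order_stat_quantile_L1) auto
  then have "E \<longlonglongrightarrow> (\<Sum>j\<in>{1..k}. 0)"
    unfolding E_def by (rule tendsto_sum)
  then have E_lim: "(\<lambda>n. ?G + E n) \<longlonglongrightarrow> ?G"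
    using tendsto_add[OF tendsto_const[of ?G]] by fastforce
  have A_bounds: "Opt n \<le> A n \<and> A n \<le> ?G + E n" if n: "0 < n" for n
  proof -
    have PM_int: "integrable (sample n) (\<lambda>x. PM n ?v x j)" if "j \<in> {1..k}" for j
      unfolding PM_def using q[OF that] n
      by (intro integrable_order_stat percentile_index_less int) auto
    have dev_int: "integrable (sample n) (\<lambda>x. \<bar>PM n ?v x j - y j\<bar>)" if "j \<in> {1..k}" for j
      using PM_int[OF that] prob_space.finite_measure[OF prob_space_sample]
      by (intro integrable_abs Bochner_Integration.integrable_diff finite_measure.integrable_const)
    have bnd_int: "integrable (sample n) (\<lambda>x. SC n k x y + (\<Sum>j\<in>{1..k}. \<bar>PM n ?v x j - y j\<bar>))"
      by (intro Bochner_Integration.integrable_add Bochner_Integration.integrable_sum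
          integrable_SC k int dev_int)
    have PM_le: "SC n k x (PM n ?v x) \<le> SC n k x y + (\<Sum>j\<in>{1..k}. \<bar>PM n ?v x j - y j\<bar>)" for x
      by (rule SC_perturb[OF k])
    have A_int: "integrable (sample n) (\<lambda>x. SC n k x (PM n ?v x))"
    proof (rule Bochner_Integration.integrable_bound[OF bnd_int])
      show "(\<lambda>x. SC n k x (PM n ?v x)) \<in> borel_measurable (sample n)"
        unfolding SC_fdist
        by (intro borel_measurable_times borel_measurable_sum borel_measurable_fdist_param
            borel_measurable_integrable[OF PM_int] k) auto
      show "AE x in sample n. norm (SC n k x (PM n ?v x))
          \<le> norm (SC n k x y + (\<Sum>j\<in>{1..k}. \<bar>PM n ?v x j - y j\<bar>))"
      proof (rule AE_I2)
        fix x
        show "norm (SC n k x (PM n ?v x)) \<le> norm (SC n k x y + (\<Sum>j\<in>{1..k}. \<bar>PM n ?v x j - y j\<bar>))"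
          using PM_le[of x] SC_nonneg[OF k, of n x "PM n ?v x"] by simp
      qed
    qed
    have "Opt n \<le> A n"
      unfolding Opt_def A_def by (intro integral_mono integrable_SC_opt k int A_int SC_opt_le)
    moreover have "A n \<le> (\<integral>x. SC n k x y + (\<Sum>j\<in>{1..k}. \<bar>PM n ?v x j - y j\<bar>) \<partial>sample n)"
      unfolding A_def by (intro integral_mono A_int bnd_int PM_le)
    moreover have "\<dots> = ?G + E n"
      unfolding E_def expectation_SC[OF k int n, of y, symmetric]
      by (subst Bochner_Integration.integral_add)
        (auto intro!: integrable_SC k int dev_int Bochner_Integration.integrable_sum
          Bochner_Integration.integral_sum)
    ultimately show ?thesis by simp
  qed
  have "A \<longlonglongrightarrow> ?G"
  proof (rule tendsto_sandwich[OF _ _ Opt_lim E_lim])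
    show "\<forall>\<^sub>F n in sequentially. Opt n \<le> A n"
      using eventually_gt_at_top[of 0] by eventually_elim (use A_bounds in blast)
    show "\<forall>\<^sub>F n in sequentially. A n \<le> ?G + E n"
      using eventually_gt_at_top[of 0] by eventually_elim (use A_bounds in blast)
  qed
  then have "(\<lambda>n. A n / Opt n) \<longlonglongrightarrow> ?G / ?G"
    using pos by (intro tendsto_divide Opt_lim) auto
  then show ?thesis using pos by (simp add: B_ar_def A_def Opt_def)
qed

end

section \<open>Median equations and interior levels at the minimiser\<close>

theorem theorem6:
  fixes \<mu> :: "real measure" and k :: nat and y w :: "nat \<Rightarrow> real"
  assumes "2 \<le> k"
    and "standing_assumptions \<mu>"
    and "integrable \<mu> (\<lambda>x. \<bar>x\<bar>)"
    and "\<forall>j\<in>{1..k}. 0 < w j" and "(\<Sum>j\<in>{1..k}. w j) = 1"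
    and "\<forall>i j. 1 \<le> i \<longrightarrow> i \<le> j \<longrightarrow> j \<le> k \<longrightarrow> y i \<le> y j"
    and "\<forall>\<nu>\<in>Pk k. W1 \<mu> (discrete_meas k y w) \<le> W1 \<mu> \<nu>"
  shows "(\<forall>j\<in>{1..k}. 0 < cdf_of \<mu> (y j) \<and> cdf_of \<mu> (y j) < 1)
    \<and> optimal_percentile_vector \<mu> k (\<lambda>j. cdf_of \<mu> (y j))
    \<and> 2 * cdf_of \<mu> (y 1) = cdf_of \<mu> ((y 1 + y 2) / 2)
    \<and> (\<forall>j\<in>{2..k-1}. 2 * (cdf_of \<mu> (y j) - cdf_of \<mu> ((y (j-1) + y j) / 2))
          = cdf_of \<mu> ((y j + y (j+1)) / 2) - cdf_of \<mu> ((y (j-1) + y j) / 2))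
    \<and> 2 * (cdf_of \<mu> (y k) - cdf_of \<mu> ((y (k-1) + y k) / 2))
          = 1 - cdf_of \<mu> ((y (k-1) + y k) / 2)"
proof -
  interpret real_distribution \<mu> by (rule standing_assumptions_real_distribution[OF assms(2)])
  have cdf_of: "cdf_of \<mu> = cdf \<mu>" by (simp add: fun_eq_iff cdf_of_def cdf_def)
  have k: "1 \<le> k" using assms(1) by simp
  note int = assms(3)
  have mono: "mono_on {1..k} y" using assms(6) by (intro mono_onI) auto
  have opt: "mean_fdist k y \<le> mean_fdist k z" for z
    by (rule W1_minimiser_mean_fdist_le[OF k int assms(7)])
  note atomless = standing_assumptions_atomless[OF assms(2)]
  obtain S where S: "open S" "S \<noteq> {}"
      "\<And>U. open U \<Longrightarrow> U \<noteq> {} \<Longrightarrow> U \<subseteq> S \<Longrightarrow> prob U \<noteq> 0"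
    and S_mem: "\<And>x. 0 < cdf \<mu> x \<Longrightarrow> cdf \<mu> x < 1 \<Longrightarrow> x \<in> S"
    by (rule standing_assumptions_support[OF assms(2)], rule that) blast+
  \<comment> \<open>One equation covers all three lines of the system: a missing left midpoint
    contributes the c.d.f. value 0, a missing right midpoint the value 1.\<close>
  have cell: "2 * (cdf \<mu> (y j) - (if j = 1 then 0 else cdf \<mu> ((y (j - 1) + y j) / 2)))
      = (if j = k then 1 else cdf \<mu> ((y j + y (j + 1)) / 2))
        - (if j = 1 then 0 else cdf \<mu> ((y (j - 1) + y j) / 2))" if "j \<in> {1..k}" for j
    using cell_median[OF k int opt mono that] isCont_cdf atomless prob_cell[OF mono that]
      prob_cell_atMost[OF mono that] by simp
  have cell_pos: "0 < prob (cell k y j)" if "j \<in> {1..k}" for j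
    by (rule prob_cell_pos[OF k int opt mono that S])
  \<comment> \<open>The first cell has no left boundary, so \<open>cdf \<mu> (y 1)\<close> is half
    of the positive mass of that cell.\<close>
  have y1: "0 < cdf \<mu> (y 1)"
    using cell_median[OF k int opt mono, of 1] isCont_cdf atomless prob_cell_atMost[OF mono, of 1]
      cell_pos[of 1] k by simp
  \<comment> \<open>The last median equation leaves half of the positive mass of the last cell
    beyond \<open>y k\<close>.\<close>
  have yk: "cdf \<mu> (y k) < 1"
    using cell[of k] cell_pos[of k] prob_cell[OF mono, of k] k by simp
  have q: "0 < cdf \<mu> (y j) \<and> cdf \<mu> (y j) < 1" if "j \<in> {1..k}" for j
  proof -
    have "y 1 \<le> y j" "y j \<le> y k" using that assms(6) by auto
    then show ?thesis using y1 yk cdf_nondecreasing by (meson less_le_trans le_less_trans)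
  qed
  have strict: "cdf \<mu> (y j - \<delta>) < cdf \<mu> (y j) \<and> cdf \<mu> (y j) < cdf \<mu> (y j + \<delta>)"
    if j: "j \<in> {1..k}" and \<delta>: "0 < \<delta>" for j \<delta>
  proof -
    have "y j \<in> S" using q[OF j] by (intro S_mem) auto
    then obtain r where r: "0 < r" "ball (y j) r \<subseteq> S" using S(1) openE by blast
    \<comment> \<open>The bound \<open>r\<close> keeps the interval inside \<open>S\<close>, the
      bound \<open>\<delta>\<close> keeps it inside the increments to be compared; both open halves
      then carry mass.\<close>
    define d where "d = min r \<delta>"
    have d: "0 < d" "d \<le> \<delta>" "d \<le> r" using r \<delta> by (auto simp: d_def)
    have "{y j - d<..<y j} \<subseteq> S" "{y j<..<y j + d} \<subseteq> S"
      using d r(2) by (auto simp: subset_iff dist_real_def)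
    then have "prob {y j - d<..<y j} \<noteq> 0" "prob {y j<..<y j + d} \<noteq> 0"
      using S(3)[of "{y j - d<..<y j}"] S(3)[of "{y j<..<y j + d}"] d by auto
    moreover have "prob {y j - d<..<y j} \<le> prob {y j - \<delta><..y j}"
        "prob {y j<..<y j + d} \<le> prob {y j<..y j + \<delta>}"
      using d by (auto intro!: finite_measure_mono)
    ultimately have "0 < prob {y j - \<delta><..y j}" "0 < prob {y j<..y j + \<delta>}"
      by (metis measure_nonneg order_antisym_conv not_le order_trans)+
    then show ?thesis using \<delta> by (simp add: prob_greaterThanAtMost)
  qed
  have "(\<lambda>n. B_ar \<mu> k n (\<lambda>j. cdf \<mu> (y j))) \<longlonglongrightarrow> 1"
    using B_ar_quantiles_tendsto_1[OF k int opt mean_fdist_pos[OF k int atomless] q strict] .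
  moreover have "percentile_vector k (\<lambda>j. cdf \<mu> (y j))"
    unfolding percentile_vector_def using q assms(6) by (auto intro!: cdf_nondecreasing intro: less_imp_le)
  moreover have "2 * cdf \<mu> (y 1) = cdf \<mu> ((y 1 + y 2) / 2)"
    using cell[of 1] assms(1) by (simp add: numeral_2_eq_2)
  moreover have "\<forall>j\<in>{2..k-1}. 2 * (cdf \<mu> (y j) - cdf \<mu> ((y (j-1) + y j) / 2))
      = cdf \<mu> ((y j + y (j+1)) / 2) - cdf \<mu> ((y (j-1) + y j) / 2)"
  proof
    fix j assume "j \<in> {2..k-1}"
    then have "j \<in> {1..k}" "j \<noteq> 1" "j \<noteq> k" by auto
    then show "2 * (cdf \<mu> (y j) - cdf \<mu> ((y (j-1) + y j) / 2))
        = cdf \<mu> ((y j + y (j+1)) / 2) - cdf \<mu> ((y (j-1) + y j) / 2)"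
      using cell[of j] by simp
  qed
  moreover have "2 * (cdf \<mu> (y k) - cdf \<mu> ((y (k-1) + y k) / 2)) = 1 - cdf \<mu> ((y (k-1) + y k) / 2)"
    using cell[of k] assms(1) by simp
  ultimately show ?thesis
    using q unfolding cdf_of optimal_percentile_vector_def by blast
qed

end
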